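(* Let $G$ be a 2-edge-connected cubic graph and let $D$ be a 2-regular subgraph of $G$ with disjoint cycles $C_1,C_2,\dots,C_k$. Then $$\mathrm{circ}(\mathrm{Blowup}(G,D))\ \le\ |V(\mathrm{Blowup}(G,D))|-\sum_{i=1}^{k}\left\lceil\frac{|V(C_i)|}{2}\right\rceil+1$$ and $$\mathrm{circ}(\mathrm{SemiBlowup}(G,D))\ \le\ |V(\mathrm{SemiBlowup}(G,D))|-\sum_{i=1}^{k}\left\lceil\frac{|V(C_i)|}{2}\right\rceil+1 .$$
   Context: The circumference $\mathrm{circ}(H)$ of a graph $H$ is the length of a longest cycle in $H$. A multipole consists of vertices, edges, and semiedges; a semiedge is an edge incident to exactly one vertex, with its other end free. Connecting a semiedge to a vertex $v$ means attaching its free end to $v$; connecting two semiedges means joining their free ends so that they become one ordinary edge. The 4-pole $B$: take the Petersen graph and remove two adjacent vertices $x,y$, keeping the four edges from $\{x,y\}$ to the remaining 8 vertices as semiedges. The two semiedges coming from edges formerly incident to $x$ are called $a_1,a_2$, and the two coming from edges formerly incident to $y$ are called $b_1,b_2$. $\mathrm{SemiBlowup}(G,D)$: for every cycle $(v_1,\dots,v_m)$ of $D$ (indices modulo $m$), remove all edges $v_iv_{i+1}$ and add $m$ copies $B_1,\dots,B_m$ of $B$, with semiedges $a_1^i,a_2^i,b_1^i,b_2^i$ of $B_i$. For all $i\in\{1,\dots,m\}$, connect $v_i$ with the semiedge $b_1^i$, connect the semiedge $a_2^i$ with the semiedge $b_2^{i+1}$, and connect $a_1^i$ with $v_{i+1}$.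 $\mathrm{Blowup}(G,D)$: for every cycle $(v_1,\dots,v_m)$ of $D$ (indices modulo $m$), remove all edges $v_iv_{i+1}$ and add $m$ copies $B_1,\dots,B_m$ of $B$, with semiedges $a_1^i,a_2^i,b_1^i,b_2^i$ of $B_i$. For each $i\in\{1,\dots,m\}$ add two new vertices $u_i,w_i$ and the edges $v_iu_i$, $v_iw_i$, and connect $u_i$ with $b_1^i$, $w_i$ with $b_2^i$, $a_1^i$ with $u_{i+1}$, and $a_2^i$ with $w_{i+1}$. *)

theory Defs
  imports Complex_Main "HOL-Library.Multiset"
begin

text \<open>
  Finite undirected multigraphs: parallel edges and loops are allowed, so a simple graph is a
  special case. Each edge has a multiset of two ends, a loop having the same end twice.
\<close>

record ('v, 'e) pre_graph =
  verts :: "'v set"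
  edges :: "'e set"
  ends :: "'e \<Rightarrow> 'v multiset"

definition graph :: "('v, 'e) pre_graph \<Rightarrow> bool" where
  "graph G \<longleftrightarrow> finite (verts G) \<and> finite (edges G) \<and>
     (\<forall>e\<in>edges G. size (ends G e) = 2 \<and> set_mset (ends G e) \<subseteq> verts G)"

text \<open>A loop contributes two to the degree of its vertex.\<close>

definition degree :: "('v, 'e) pre_graph \<Rightarrow> 'v \<Rightarrow> nat" where
  "degree G v = (\<Sum>e\<in>edges G. count (ends G e) v)"

definition regular :: "nat \<Rightarrow> ('v, 'e) pre_graph \<Rightarrow> bool" where
  "regular r G \<longleftrightarrow> (\<forall>v\<in>verts G. degree G v = r)"

abbreviation cubic :: "('v, 'e) pre_graph \<Rightarrow> bool" where
  "cubic G \<equiv> regular 3 G"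

definition subgraph :: "('v, 'e) pre_graph \<Rightarrow> ('v, 'e) pre_graph \<Rightarrow> bool" where
  "subgraph D G \<longleftrightarrow> graph D \<and> verts D \<subseteq> verts G \<and> edges D \<subseteq> edges G \<and>
     (\<forall>e\<in>edges D. ends D e = ends G e)"

definition adjacency :: "('v, 'e) pre_graph \<Rightarrow> ('v \<times> 'v) set" where
  "adjacency G = {(u, v). \<exists>e\<in>edges G. ends G e = {#u, v#}}"

definition connected_graph :: "('v, 'e) pre_graph \<Rightarrow> bool" where
  "connected_graph G \<longleftrightarrow> verts G \<noteq> {} \<and> (\<forall>u\<in>verts G. \<forall>v\<in>verts G. (u, v) \<in> (adjacency G)\<^sup>*)"

definition delete_edges :: "('v, 'e) pre_graph \<Rightarrow> 'e set \<Rightarrow> ('v, 'e) pre_graph" where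
  "delete_edges G F = G\<lparr>edges := edges G - F\<rparr>"

definition edge_connected :: "nat \<Rightarrow> ('v, 'e) pre_graph \<Rightarrow> bool" where
  "edge_connected k G \<longleftrightarrow> card (verts G) > 1 \<and>
     (\<forall>F \<subseteq> edges G. card F < k \<longrightarrow> connected_graph (delete_edges G F))"

text \<open>
  A cycle is given by its cyclic sequence \<open>[(v\<^sub>1, e\<^sub>1), \<dots>, (v\<^sub>m, e\<^sub>m)]\<close> of distinct vertices and
  distinct edges, where \<open>e\<^sub>i\<close> joins \<open>v\<^sub>i\<close> to \<open>v\<^sub>i\<^sub>+\<^sub>1\<close> (indices modulo \<open>m\<close>). Loops (\<open>m = 1\<close>) and pairs of
  parallel edges (\<open>m = 2\<close>) are cycles.
\<close>

definition is_cycle :: "('v, 'e) pre_graph \<Rightarrow> ('v \<times> 'e) list \<Rightarrow> bool" where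
  "is_cycle G C \<longleftrightarrow> C \<noteq> [] \<and> distinct (map fst C) \<and> distinct (map snd C) \<and>
     (\<forall>i<length C. snd (C ! i) \<in> edges G \<and>
        ends G (snd (C ! i)) = {#fst (C ! i), fst (C ! (Suc i mod length C))#})"

definition cycle_verts :: "('v \<times> 'e) list \<Rightarrow> 'v set" where
  "cycle_verts C = fst ` set C"

definition cycle_edges :: "('v \<times> 'e) list \<Rightarrow> 'e set" where
  "cycle_edges C = snd ` set C"

text \<open>Only meaningful for graphs that contain a cycle.\<close>

definition circ :: "('v, 'e) pre_graph \<Rightarrow> nat" where
  "circ G = Max {length C | C. is_cycle G C}"

text \<open>
  \<open>Cs\<close> lists the cycles of the 2-regular graph \<open>D\<close>, each with an arbitrary starting vertex and
  direction.
\<close>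

definition disjoint_cycles :: "('v, 'e) pre_graph \<Rightarrow> ('v \<times> 'e) list list \<Rightarrow> bool" where
  "disjoint_cycles D Cs \<longleftrightarrow>
     (\<forall>C\<in>set Cs. is_cycle D C) \<and>
     (\<forall>i<length Cs. \<forall>j<length Cs. i \<noteq> j \<longrightarrow> cycle_verts (Cs ! i) \<inter> cycle_verts (Cs ! j) = {}) \<and>
     verts D = (\<Union>C\<in>set Cs. cycle_verts C) \<and>
     edges D = (\<Union>C\<in>set Cs. cycle_edges C)"

text \<open>
  The Petersen graph: outer cycle \<open>0, \<dots>, 4\<close>, spokes, and inner pentagram on \<open>5, \<dots>, 9\<close>.
\<close>

definition petersen_verts :: "nat set" where
  "petersen_verts = {..<10}"

definition petersen_edges :: "nat multiset set" where
  "petersen_edges =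
     (\<Union>i<5. {{#i, (i + 1) mod 5#}, {#i, i + 5#}, {#i + 5, (i + 2) mod 5 + 5#}})"

text \<open>
  The 4-pole \<open>B\<close>, with the adjacent vertices \<open>x = 0\<close> and \<open>y = 1\<close> removed. A semiedge is represented
  by its label, and \<open>foot\<close> gives the vertex of \<open>B\<close> it is incident to. The choice of \<open>x\<close>, \<open>y\<close> and the
  labelling does not matter, as the automorphism group of the Petersen graph is transitive on
  paths \<open>(p, x, y, q)\<close>.
\<close>

definition B_verts :: "nat set" where
  "B_verts = petersen_verts - {0, 1}"

definition B_edges :: "nat multiset set" where
  "B_edges = {e \<in> petersen_edges. 0 \<notin># e \<and> 1 \<notin># e}"

datatype semiedge = A1 | A2 | B1 | B2

fun foot :: "semiedge \<Rightarrow> nat" where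
  "foot A1 = 4"
| "foot A2 = 5"
| "foot B1 = 2"
| "foot B2 = 6"

lemma petersen_edges_explicit:
  "petersen_edges =
     {{#0, 1#}, {#0, 5#}, {#5, 7#},
      {#1, 2#}, {#1, 6#}, {#6, 8#},
      {#2, 3#}, {#2, 7#}, {#7, 9#},
      {#3, 4#}, {#3, 8#}, {#8, 5#},
      {#4, 0#}, {#4, 9#}, {#9, 6#}}"
proof -
  have "{..<5} = {0, 1, 2, 3, 4 :: nat}"
    by auto
  then show ?thesis
    unfolding petersen_edges_def
    by (simp only: UN_insert UN_empty Un_insert_left Un_empty_left Un_empty_right)
      (simp add: numeral_2_eq_2)
qed

lemma Collect_mem_insert_conj:
  "{e \<in> insert a S. P e} = (if P a then insert a {e \<in> S. P e} else {e \<in> S. P e})"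
  by auto

lemma edges_at_x_y:
  "{e \<in> petersen_edges. 0 \<in># e} = {{#0, 1#}, {#foot A1, 0#}, {#0, foot A2#}}"
  "{e \<in> petersen_edges. 1 \<in># e} = {{#0, 1#}, {#1, foot B1#}, {#1, foot B2#}}"
  unfolding petersen_edges_explicit Collect_mem_insert_conj by auto

lemma B_edges_explicit:
  "B_edges = {{#5, 7#}, {#6, 8#}, {#2, 3#}, {#2, 7#}, {#7, 9#},
     {#3, 4#}, {#3, 8#}, {#8, 5#}, {#4, 9#}, {#9, 6#}}"
  unfolding B_edges_def petersen_edges_explicit Collect_mem_insert_conj by simp

text \<open>
  Cycles and positions are indexed from 0: \<open>InB j i p\<close> is the copy of the vertex \<open>p\<close> of \<open>B\<close> in the
  \<open>i\<close>-th copy of \<open>B\<close> for the \<open>j\<close>-th cycle, and \<open>U j i\<close>, \<open>W j i\<close> are the new vertices \<open>u\<^sub>i\<close>, \<open>w\<^sub>i\<close> for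
  that cycle. New edges are identified by their ends, which loses nothing since the
  constructions never create two parallel new edges.
\<close>

datatype 'v blow_vertex = Orig 'v | InB nat nat nat | U nat nat | W nat nat

datatype ('v, 'e) blow_edge = OrigE 'e | NewE "'v blow_vertex multiset"

fun blow_ends :: "('v, 'e) pre_graph \<Rightarrow> ('v, 'e) blow_edge \<Rightarrow> 'v blow_vertex multiset" where
  "blow_ends G (OrigE e) = image_mset Orig (ends G e)"
| "blow_ends G (NewE s) = s"

definition positions :: "('v \<times> 'e) list list \<Rightarrow> (nat \<times> nat) set" where
  "positions Cs = {(j, i). j < length Cs \<and> i < length (Cs ! j)}"

definition cyc_vertex :: "('v \<times> 'e) list list \<Rightarrow> nat \<Rightarrow> nat \<Rightarrow> 'v blow_vertex" where
  "cyc_vertex Cs j i = Orig (fst (Cs ! j ! i))"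

definition semi :: "nat \<Rightarrow> nat \<Rightarrow> semiedge \<Rightarrow> 'v blow_vertex" where
  "semi j i s = InB j i (foot s)"

definition next_pos :: "('v \<times> 'e) list list \<Rightarrow> nat \<Rightarrow> nat \<Rightarrow> nat" where
  "next_pos Cs j i = Suc i mod length (Cs ! j)"

definition kept_edges :: "('v, 'e) pre_graph \<Rightarrow> ('v \<times> 'e) list list \<Rightarrow> ('v, 'e) blow_edge set" where
  "kept_edges G Cs = OrigE ` (edges G - (\<Union>C\<in>set Cs. cycle_edges C))"

definition B_copies_verts :: "('v \<times> 'e) list list \<Rightarrow> 'v blow_vertex set" where
  "B_copies_verts Cs = (\<Union>(j, i)\<in>positions Cs. InB j i ` B_verts)"

definition B_copies_edges :: "('v \<times> 'e) list list \<Rightarrow> ('v, 'e) blow_edge set" where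
  "B_copies_edges Cs = (\<Union>(j, i)\<in>positions Cs. (\<lambda>e. NewE (image_mset (InB j i) e)) ` B_edges)"

definition semiblowup ::
  "('v, 'e) pre_graph \<Rightarrow> ('v \<times> 'e) list list \<Rightarrow> ('v blow_vertex, ('v, 'e) blow_edge) pre_graph" where
  "semiblowup G Cs = \<lparr>
     verts = Orig ` verts G \<union> B_copies_verts Cs,
     edges = kept_edges G Cs \<union> B_copies_edges Cs \<union>
       (\<Union>(j, i)\<in>positions Cs. let i' = next_pos Cs j i in
          {NewE {#cyc_vertex Cs j i, semi j i B1#},
           NewE {#semi j i A2, semi j i' B2#},
           NewE {#semi j i A1, cyc_vertex Cs j i'#}}),
     ends = blow_ends G\<rparr>"

definition blowup ::
  "('v, 'e) pre_graph \<Rightarrow> ('v \<times> 'e) list list \<Rightarrow> ('v blow_vertex, ('v, 'e) blow_edge) pre_graph" where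
  "blowup G Cs = \<lparr>
     verts = Orig ` verts G \<union> B_copies_verts Cs \<union> (\<Union>(j, i)\<in>positions Cs. {U j i, W j i}),
     edges = kept_edges G Cs \<union> B_copies_edges Cs \<union>
       (\<Union>(j, i)\<in>positions Cs. let i' = next_pos Cs j i in
          {NewE {#cyc_vertex Cs j i, U j i#},
           NewE {#cyc_vertex Cs j i, W j i#},
           NewE {#U j i, semi j i B1#},
           NewE {#W j i, semi j i B2#},
           NewE {#semi j i A1, U j i'#},
           NewE {#semi j i A2, W j i'#}}),
     ends = blow_ends G\<rparr>"

end

theory Submission imports Defs begin

text \<open>
  If a cycle \<open>K\<close> of the blowup covers all of a copy of \<open>B\<close> and also leaves it, then it enters
  and leaves that copy through the \<open>a\<close>-semiedges together or through the \<open>b\<close>-semiedges together,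
  and the part of \<open>K\<close> inside the copy never joins an \<open>a\<close>-semiedge to a \<open>b\<close>-semiedge: this is
  the non-hamiltonicity of the Petersen graph. Hence, if \<open>K\<close> covers \<open>B\<^sub>i\<close>, \<open>v\<^sub>i\<^sub>+\<^sub>1\<close> and \<open>B\<^sub>i\<^sub>+\<^sub>1\<close>, it
  closes up around \<open>v\<^sub>i\<^sub>+\<^sub>1\<close> and meets no other vertex of \<open>G\<close>, which can happen for at most one
  position \<open>i\<close> in all cycles of \<open>D\<close>. Every other triple \<open>(B\<^sub>i, v\<^sub>i\<^sub>+\<^sub>1, B\<^sub>i\<^sub>+\<^sub>1)\<close> misses a vertex. Each
  missed vertex accounts for at most two triples, so about half of the cycle length is lost.
\<close>

section \<open>Cycles and two-factors of the pole\<close>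

definition two_of :: "bool \<Rightarrow> bool \<Rightarrow> bool \<Rightarrow> bool" where
  "two_of a b c \<longleftrightarrow> (of_bool a + of_bool b + of_bool c = (2::nat))"

text \<open>Clausal form of the count, which makes \<open>B_two_factor\<close> a purely
  propositional problem.\<close>

lemma two_of_iff: "two_of a b c \<longleftrightarrow> (a \<or> b) \<and> (a \<or> c) \<and> (b \<or> c) \<and> (\<not> a \<or> \<not> b \<or> \<not> c)"
  by (auto simp: two_of_def)

text \<open>
  The variables say which edges and semiedges of \<open>B\<close> are used. The last four assumptions exclude
  the two-factors that contain a closed cycle inside \<open>B\<close>, on one of the four 5-cycles of \<open>B\<close>.
\<close>

lemma B_two_factor:
  assumes "two_of x23 x27 b1" "two_of x23 x34 x38" "two_of x34 x49 a1" "two_of x57 x58 a2"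
    "two_of x68 x69 b2" "two_of x27 x57 x79" "two_of x38 x58 x68" "two_of x49 x69 x79"
    and "x27 \<or> x38 \<or> x49 \<or> a2 \<or> b2" "x23 \<or> x58 \<or> x79 \<or> a1 \<or> b2"
    and "x34 \<or> x79 \<or> x68 \<or> a2 \<or> b1" "x38 \<or> x57 \<or> x69 \<or> a1 \<or> b1"
  shows "(a1 \<longleftrightarrow> a2) \<and> (b1 \<longleftrightarrow> b2) \<and>
    (a1 \<and> b1 \<longrightarrow> \<not> x34 \<and> \<not> x27 \<and> \<not> x69 \<and> \<not> x58 \<or> \<not> x23 \<and> \<not> x49 \<and> \<not> x57 \<and> \<not> x68)"
  using assms unfolding two_of_iff by sat

section \<open>Degrees and connectivity along a cycle\<close>

lemma bij_betw_Suc_mod: "bij_betw (\<lambda>k. Suc k mod n) {..<n} {..<n}"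
proof -
  have "inj_on (\<lambda>k. Suc k mod n) {..<n}"
    by (auto intro!: inj_onI simp: mod_Suc split: if_splits)
  moreover have "(\<lambda>k. Suc k mod n) ` {..<n} \<subseteq> {..<n}"
    by auto
  ultimately show ?thesis
    by (simp add: bij_betw_def endo_inj_surj)
qed

text \<open>A vertex of \<open>C\<close> sits at exactly one index, so it is the first end of one
  edge and, the cyclic shift being a bijection, the second end of one edge. As ends are counted with
  multiplicity, loops and pairs of parallel edges are included.\<close>

lemma cycle_degree:
  assumes "is_cycle G C" "v \<in> cycle_verts C"
  shows "(\<Sum>e\<in>cycle_edges C. count (ends G e) v) = 2"
proof -
  let ?n = "length C"
  have C: "C \<noteq> []" "distinct (map fst C)" "distinct (map snd C)"
    and e: "\<And>k. k < ?n \<Longrightarrow> ends G (snd (C ! k)) = {#fst (C ! k), fst (C ! (Suc k mod ?n))#}"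
    using assms(1) by (auto simp: is_cycle_def)
  have one: "(\<Sum>k<?n. of_bool (fst (C ! k) = v)) = (1::nat)"
  proof -
    obtain k where k: "k < ?n" "fst (C ! k) = v"
      using assms(2) by (auto simp: cycle_verts_def in_set_conv_nth)
    have "of_bool (fst (C ! l) = v) = (of_bool (l = k) :: nat)" if "l < ?n" for l
      using that k C(2) nth_eq_iff_index_eq[of "map fst C" l k] by auto
    then have "(\<Sum>l<?n. of_bool (fst (C ! l) = v)) = (\<Sum>l<?n. of_bool (l = k) :: nat)"
      by (intro sum.cong) auto
    also have "\<dots> = 1"
      using k by (simp add: of_bool_def)
    finally show ?thesis .
  qed
  have "(\<Sum>e\<in>cycle_edges C. count (ends G e) v) = (\<Sum>k<?n. count (ends G (snd (C ! k))) v)"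
  proof -
    have "cycle_edges C = (\<lambda>k. snd (C ! k)) ` {..<?n}"
      by (force simp: cycle_edges_def in_set_conv_nth)
    moreover have "inj_on (\<lambda>k. snd (C ! k)) {..<?n}"
      using C(3) nth_eq_iff_index_eq[of "map snd C"] by (auto intro!: inj_onI)
    ultimately show ?thesis
      by (simp add: sum.reindex)
  qed
  also have "\<dots> = (\<Sum>k<?n. of_bool (fst (C ! k) = v) + of_bool (fst (C ! (Suc k mod ?n)) = v))"
    by (intro sum.cong) (auto simp: e)
  also have "\<dots> = 2"
    using one sum.reindex_bij_betw[OF bij_betw_Suc_mod, of "\<lambda>k. of_bool (fst (C ! k) = v) :: nat" ?n]
    by (simp add: sum.distrib)
  finally show ?thesis .
qed

text \<open>Going round \<open>C\<close> from \<open>v\<close>, no edge can leave \<open>S\<close>.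
  This is how a cycle is later confined to a region in which it closes up.\<close>

lemma cycle_connected:
  assumes "is_cycle G C" "v \<in> cycle_verts C" "v \<in> S"
    and closed: "\<And>e. e \<in> cycle_edges C \<Longrightarrow> set_mset (ends G e) \<inter> S \<noteq> {} \<Longrightarrow> set_mset (ends G e) \<subseteq> S"
  shows "cycle_verts C \<subseteq> S"
proof -
  let ?n = "length C"
  have C: "C \<noteq> []"
    and e: "\<And>k. k < ?n \<Longrightarrow> ends G (snd (C ! k)) = {#fst (C ! k), fst (C ! (Suc k mod ?n))#}"
    using assms(1) by (auto simp: is_cycle_def)
  have step: "fst (C ! (Suc k mod ?n)) \<in> S" if "k < ?n" "fst (C ! k) \<in> S" for k
    using closed[of "snd (C ! k)"] e[OF that(1)] that by (auto simp: cycle_edges_def)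
  obtain k where k: "k < ?n" "fst (C ! k) = v"
    using assms(2) by (auto simp: cycle_verts_def in_set_conv_nth)
  have from_k: "fst (C ! ((k + l) mod ?n)) \<in> S" for l
  proof (induction l)
    case 0
    then show ?case using k assms(3) by simp
  next
    case (Suc l)
    then show ?case
      using step[of "(k + l) mod ?n"] C by (simp add: mod_Suc_eq)
  qed
  show ?thesis
  proof
    fix w assume "w \<in> cycle_verts C"
    then obtain l where l: "l < ?n" "w = fst (C ! l)"
      by (auto simp: cycle_verts_def in_set_conv_nth)
    \<comment> \<open>Adding \<open>?n\<close> first keeps the subtraction from truncating when
      \<open>l < k\<close>.\<close>
    have "(k + (l + ?n - k)) mod ?n = l"
      using k l by simp
    then show "w \<in> S"
      using from_k[of "l + ?n - k"] l by simp
  qed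
qed

lemma cycle_edges_subset: "is_cycle G C \<Longrightarrow> cycle_edges C \<subseteq> edges G"
  by (fastforce simp: is_cycle_def cycle_edges_def in_set_conv_nth)

lemma cycle_verts_subset:
  assumes "is_cycle G C" "\<And>e. e \<in> edges G \<Longrightarrow> set_mset (ends G e) \<subseteq> verts G"
  shows "cycle_verts C \<subseteq> verts G"
proof
  fix v assume "v \<in> cycle_verts C"
  then obtain k where "k < length C" "v = fst (C ! k)"
    by (auto simp: cycle_verts_def in_set_conv_nth)
  then show "v \<in> verts G"
    using assms(1) assms(2)[of "snd (C ! k)"] by (auto simp: is_cycle_def)
qed

lemma card_cycle_verts: "is_cycle G C \<Longrightarrow> card (cycle_verts C) = length C"
  by (metis cycle_verts_def distinct_card is_cycle_def length_map set_map)

section \<open>Cycles through a copy of the pole\<close>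

lemma pair_mset_eq_iff: "{#a, b#} = {#c, d#} \<longleftrightarrow> a = c \<and> b = d \<or> a = d \<and> b = c"
  by (auto simp: add_eq_conv_diff)

text \<open>By \<open>cycle_degree\<close> the edges of \<open>K\<close> have two ends at
  \<open>v\<close>, and each of the three candidates supplies exactly one end if it is used.\<close>

lemma two_of_incident:
  assumes "is_cycle H K" "v \<in> cycle_verts K"
    and inc: "\<And>e. e \<in> edges H \<Longrightarrow> v \<in># ends H e \<Longrightarrow> e \<in> {e1, e2, e3}"
    and distinct: "distinct [e1, e2, e3]"
    and simple: "count (ends H e1) v = 1" "count (ends H e2) v = 1" "count (ends H e3) v = 1"
  shows "two_of (e1 \<in> cycle_edges K) (e2 \<in> cycle_edges K) (e3 \<in> cycle_edges K)"
proof -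
  have fin: "finite (cycle_edges K)"
    by (simp add: cycle_edges_def)
  have "2 = (\<Sum>e\<in>cycle_edges K. count (ends H e) v)"
    using cycle_degree[OF assms(1,2)] by simp
  also have "\<dots> = (\<Sum>e\<in>cycle_edges K \<inter> {e1, e2, e3}. count (ends H e) v)"
  proof (rule sum.mono_neutral_right)
    show "\<forall>e\<in>cycle_edges K - cycle_edges K \<inter> {e1, e2, e3}. count (ends H e) v = 0"
      using inc cycle_edges_subset[OF assms(1)] by (meson DiffE IntI not_in_iff subsetD)
  qed (use fin in auto)
  also have "\<dots> = (\<Sum>e\<in>{e1, e2, e3}. if e \<in> cycle_edges K then count (ends H e) v else 0)"
    using sum.inter_restrict[of "{e1, e2, e3}" _ "cycle_edges K"] by (simp add: Int_commute)
  also have "\<dots> = of_bool (e1 \<in> cycle_edges K) + of_bool (e2 \<in> cycle_edges K) + of_bool (e3 \<in> cycle_edges K)"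
    using distinct simple by (simp add: of_bool_def)
  finally show ?thesis
    by (simp add: two_of_def)
qed

definition B_edge :: "nat \<Rightarrow> nat \<Rightarrow> nat multiset \<Rightarrow> ('v, 'e) blow_edge" where
  "B_edge j i e = NewE (image_mset (InB j i) e)"

lemma B_verts_explicit: "B_verts = {2, 3, 4, 5, 6, 7, 8, 9}"
  by (auto simp: B_verts_def petersen_verts_def)

lemma B_edges_at:
  "{s \<in> B_edges. 2 \<in># s} = {{#2, 3#}, {#2, 7#}}"
  "{s \<in> B_edges. 3 \<in># s} = {{#2, 3#}, {#3, 4#}, {#3, 8#}}"
  "{s \<in> B_edges. 4 \<in># s} = {{#3, 4#}, {#4, 9#}}"
  "{s \<in> B_edges. 5 \<in># s} = {{#5, 7#}, {#8, 5#}}"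
  "{s \<in> B_edges. 6 \<in># s} = {{#6, 8#}, {#9, 6#}}"
  "{s \<in> B_edges. 7 \<in># s} = {{#2, 7#}, {#5, 7#}, {#7, 9#}}"
  "{s \<in> B_edges. 8 \<in># s} = {{#3, 8#}, {#8, 5#}, {#6, 8#}}"
  "{s \<in> B_edges. 9 \<in># s} = {{#4, 9#}, {#9, 6#}, {#7, 9#}}"
  unfolding B_edges_explicit Collect_mem_insert_conj by auto

lemma foot_in_B_verts: "foot s \<in> B_verts"
  by (cases s) (auto simp: B_verts_explicit)

text \<open>
  \<open>far s\<close> is the vertex to which the semiedge \<open>s\<close> of the copy is connected. It may belong to the
  same copy: in the semiblowup along a loop, \<open>A2\<close> is connected to \<open>B2\<close> of the same copy.
\<close>

locale cycle_through_B =
  fixes H :: "('v blow_vertex, ('v, 'e) blow_edge) pre_graph"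
    and K :: "('v blow_vertex \<times> ('v, 'e) blow_edge) list"
    and G :: "('v, 'e) pre_graph" and j i :: nat and far :: "semiedge \<Rightarrow> 'v blow_vertex"
  assumes cycle: "is_cycle H K"
    and ends_H: "ends H = blow_ends G"
    and incident: "\<And>e p. e \<in> edges H \<Longrightarrow> InB j i p \<in># blow_ends G e \<Longrightarrow>
      (\<exists>s\<in>B_edges. p \<in># s \<and> e = B_edge j i s) \<or> (\<exists>s. foot s = p \<and> e = NewE {#semi j i s, far s#})"
    and far: "\<And>s q. far s = InB j i q \<Longrightarrow> q \<noteq> foot s \<and> {#foot s, q#} \<notin> B_edges"
begin

abbreviation "F \<equiv> cycle_edges K"
abbreviation "X \<equiv> cycle_verts K"
abbreviation "link s \<equiv> NewE {#semi j i s, far s#} :: ('v, 'e) blow_edge"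

text \<open>In use, \<open>S\<close> carries the part of \<open>K\<close> that runs between the two
  semiedges in \<open>T\<close>; with \<open>T\<close> empty, \<open>S\<close> would carry all of
  \<open>K\<close>. Only edges of \<open>K\<close> are constrained, as
  \<open>cycle_connected\<close> requires.\<close>

definition closed_via :: "semiedge set \<Rightarrow> nat set \<Rightarrow> bool" where
  "closed_via T S \<longleftrightarrow> (\<forall>e\<in>F. set_mset (blow_ends G e) \<inter> InB j i ` S \<noteq> {} \<longrightarrow>
     set_mset (blow_ends G e) \<subseteq> InB j i ` S \<or> e \<in> link ` T)"

text \<open>By \<open>incident\<close> the edges at a copy vertex are edges of \<open>B\<close> or
  links, so closedness becomes a finite check on \<open>B_edges\<close> and the four
  semiedges.\<close>

lemma closed_viaI:
  assumes "\<And>s. s \<in> B_edges \<Longrightarrow> B_edge j i s \<in> F \<Longrightarrow> set_mset s \<inter> S = {} \<or> set_mset s \<subseteq> S"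
    and "\<And>s. foot s \<in> S \<Longrightarrow> link s \<in> F \<Longrightarrow> s \<in> T"
  shows "closed_via T S"
  unfolding closed_via_def
proof (intro ballI impI)
  fix e assume e: "e \<in> F" "set_mset (blow_ends G e) \<inter> InB j i ` S \<noteq> {}"
  then obtain p where p: "p \<in> S" "InB j i p \<in># blow_ends G e"
    by auto
  have "e \<in> edges H"
    using e cycle cycle_edges_subset by blast
  from incident[OF this p(2)]
  show "set_mset (blow_ends G e) \<subseteq> InB j i ` S \<or> e \<in> link ` T"
  proof (elim disjE bexE exE conjE)
    fix s assume "s \<in> B_edges" "p \<in># s" "e = B_edge j i s"
    then show ?thesis
      using assms(1)[of s] e p by (auto simp: B_edge_def)
  next
    fix s assume "foot s = p" "e = link s"
    then show ?thesis
      using assms(2)[of s] e p by auto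
  qed
qed

text \<open>Without exits, \<open>cycle_connected\<close> would confine \<open>K\<close> to the
  copy, against its vertex \<open>z\<close> outside.\<close>

lemma not_closed_via_empty:
  assumes "p \<in> S" "InB j i p \<in> X" "z \<in> X" "z \<notin> range (InB j i)"
  shows "\<not> closed_via {} S"
proof
  assume "closed_via {} S"
  then have "X \<subseteq> InB j i ` S"
    using assms by (intro cycle_connected[OF cycle]) (auto simp: closed_via_def ends_H)
  then show False
    using assms by auto
qed

text \<open>New edges are identified by their ends, so a link whose far end lies in the same copy
  might coincide with an edge of \<open>B\<close>; the assumption \<open>far\<close> excludes
  this.\<close>

lemma B_edge_link_distinct: "s \<in> B_edges \<Longrightarrow> B_edge j i s \<noteq> link t"
proof
  assume s: "s \<in> B_edges" and eq: "B_edge j i s = link t"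
  then obtain a b where ab: "s = {#a, b#}"
    by (auto simp: B_edges_explicit)
  then show False
    using s eq far[of t a] far[of t b]
    by (auto simp: B_edge_def semi_def pair_mset_eq_iff add_mset_commute)
qed

lemma count_link: "count (ends H (link s)) (InB j i (foot s)) = 1"
  using far[of s "foot s"] by (auto simp: ends_H semi_def)

lemma count_B_edge: "count (ends H (B_edge j i s)) (InB j i p) = count s p"
proof -
  have "count (image_mset (InB j i) s) (InB j i p) = count s p"
    by (induction s) auto
  then show ?thesis
    by (simp add: B_edge_def ends_H)
qed

lemma B_edge_inject: "(B_edge j i s :: ('v, 'e) blow_edge) = B_edge j i t \<longleftrightarrow> s = t"
  by (metis count_B_edge multiset_eqI)

text \<open>A foot has two edges in \<open>B\<close>, and since \<open>foot\<close> is injective the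
  only other edge there is its own link.\<close>

lemma two_of_semi:
  assumes "InB j i (foot t) \<in> X" "{s \<in> B_edges. foot t \<in># s} = {s1, s2}" "s1 \<noteq> s2"
   "count s1 (foot t) = 1" "count s2 (foot t) = 1"
  shows "two_of (B_edge j i s1 \<in> F) (B_edge j i s2 \<in> F) (link t \<in> F)"
proof (rule two_of_incident[OF cycle assms(1)])
  have s12: "s1 \<in> B_edges" "s2 \<in> B_edges"
    using assms(2) by auto
  then show "distinct [B_edge j i s1, B_edge j i s2, link t]"
    using B_edge_link_distinct[of _ t] assms(3) by (auto simp: B_edge_inject)
  fix e assume "e \<in> edges H" "InB j i (foot t) \<in># ends H e"
  from incident[OF this[unfolded ends_H]]
  show "e \<in> {B_edge j i s1, B_edge j i s2, link t}"
  proof (elim disjE bexE exE conjE)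
    fix s assume "s \<in> B_edges" "foot t \<in># s" "e = B_edge j i s"
    then have "s \<in> {s1, s2}"
      using assms(2) by blast
    then show ?thesis
      using \<open>e = _\<close> by auto
  next
    fix s assume "foot s = foot t" "e = link s"
    then have "s = t"
      by (cases s; cases t) auto
    then show ?thesis
      using \<open>e = _\<close> by auto
  qed
qed (use assms count_link count_B_edge in auto)

text \<open>Meant for the vertices 3, 7, 8, 9, which carry no semiedge and have all three edges
  inside \<open>B\<close>.\<close>

lemma two_of_inner:
  assumes "InB j i p \<in> X" "{s \<in> B_edges. p \<in># s} = {s1, s2, s3}" "distinct [s1, s2, s3]"
    "count s1 p = 1" "count s2 p = 1" "count s3 p = 1" "p \<notin> range foot"
  shows "two_of (B_edge j i s1 \<in> F) (B_edge j i s2 \<in> F) (B_edge j i s3 \<in> F)"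
proof (rule two_of_incident[OF cycle assms(1)])
  show "distinct [B_edge j i s1, B_edge j i s2, B_edge j i s3 :: ('v, 'e) blow_edge]"
    using assms(3) by (auto simp: B_edge_inject)
  fix e assume "e \<in> edges H" "InB j i p \<in># ends H e"
  from incident[OF this[unfolded ends_H]]
  obtain s where s: "s \<in> B_edges" "p \<in># s" "e = B_edge j i s"
    using assms(7) by auto
  then have "s \<in> {s1, s2, s3}"
    using assms(2) by blast
  then show "e \<in> {B_edge j i s1, B_edge j i s2, B_edge j i s3}"
    using s by auto
qed (use assms count_B_edge in auto)

text \<open>Degree two at all eight vertices and the absence of closed 5-cycles are the hypotheses
  of \<open>B_two_factor\<close>. The vertex \<open>z\<close> guarantees that \<open>K\<close> does
  not stay inside the copy.\<close>

lemma covered: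
  assumes cov: "InB j i ` B_verts \<subseteq> X" and z: "z \<in> X" "z \<notin> range (InB j i)"
  shows covered_A: "link A1 \<in> F \<longleftrightarrow> link A2 \<in> F"
    and covered_B: "link B1 \<in> F \<longleftrightarrow> link B2 \<in> F"
    and covered_closed_A: "link A1 \<in> F \<Longrightarrow> \<exists>S. 4 \<in> S \<and> 5 \<in> S \<and> closed_via {A1, A2} S"
    and covered_closed_B: "link B1 \<in> F \<Longrightarrow> \<exists>S. 2 \<in> S \<and> 6 \<in> S \<and> closed_via {B1, B2} S"
proof -
  let ?x = "\<lambda>a b. B_edge j i {#a, b#} \<in> F"
  note at = B_edges_at pair_mset_eq_iff
  have X: "InB j i p \<in> X" if "p \<in> B_verts" for p
    using that cov by auto
  have not_closed: "\<not> closed_via {} S" if "p \<in> S" "p \<in> B_verts" for p S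
    using not_closed_via_empty[OF that(1) X[OF that(2)] z] .
  have range_foot: "range foot = {4, 5, 2, 6}"
  proof -
    have "UNIV = {A1, A2, B1, B2}"
      using semiedge.exhaust by auto
    then have "range foot = foot ` {A1, A2, B1, B2}"
      by (rule arg_cong)
    then show ?thesis
      by (simp only: image_insert image_empty foot.simps)
  qed
  have closed: "closed_via T S"
    if "\<forall>s\<in>B_edges. B_edge j i s \<in> F \<longrightarrow> set_mset s \<inter> S = {} \<or> set_mset s \<subseteq> S"
      "\<forall>s. foot s \<in> S \<longrightarrow> link s \<in> F \<longrightarrow> s \<in> T" for T S
    using that by (intro closed_viaI) auto
  have all_semi: "(\<forall>s. P s) \<longleftrightarrow> P A1 \<and> P A2 \<and> P B1 \<and> P B2" for P
    by (metis semiedge.exhaust)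
  have "two_of (?x 2 3) (?x 2 7) (link B1 \<in> F)"
    using two_of_semi[of B1 "{#2, 3#}" "{#2, 7#}"] X by (simp add: at B_verts_explicit)
  moreover have "two_of (?x 2 3) (?x 3 4) (?x 3 8)"
    using two_of_inner[of 3 "{#2, 3#}" "{#3, 4#}" "{#3, 8#}"] X
    by (simp add: at B_verts_explicit range_foot)
  moreover have "two_of (?x 3 4) (?x 4 9) (link A1 \<in> F)"
    using two_of_semi[of A1 "{#3, 4#}" "{#4, 9#}"] X by (simp add: at B_verts_explicit)
  moreover have "two_of (?x 5 7) (?x 8 5) (link A2 \<in> F)"
    using two_of_semi[of A2 "{#5, 7#}" "{#8, 5#}"] X by (simp add: at B_verts_explicit)
  moreover have "two_of (?x 6 8) (?x 9 6) (link B2 \<in> F)"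
    using two_of_semi[of B2 "{#6, 8#}" "{#9, 6#}"] X by (simp add: at B_verts_explicit)
  moreover have "two_of (?x 2 7) (?x 5 7) (?x 7 9)"
    using two_of_inner[of 7 "{#2, 7#}" "{#5, 7#}" "{#7, 9#}"] X
    by (simp add: at B_verts_explicit range_foot)
  moreover have "two_of (?x 3 8) (?x 8 5) (?x 6 8)"
    using two_of_inner[of 8 "{#3, 8#}" "{#8, 5#}" "{#6, 8#}"] X
    by (simp add: at B_verts_explicit range_foot)
  moreover have "two_of (?x 4 9) (?x 9 6) (?x 7 9)"
    using two_of_inner[of 9 "{#4, 9#}" "{#9, 6#}" "{#7, 9#}"] X
    by (simp add: at B_verts_explicit range_foot)
  \<comment> \<open>Five edges or semiedges leave each 5-cycle of \<open>B\<close>. If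
    \<open>K\<close> used none of them, it would be closed on those five vertices. The four sets
    below are the vertex sets of the four 5-cycles.\<close>
  moreover have "?x 2 7 \<or> ?x 3 8 \<or> ?x 4 9 \<or> link A2 \<in> F \<or> link B2 \<in> F"
    using not_closed[of 5 "{5, 6, 7, 8, 9}"] closed[of "{5, 6, 7, 8, 9}" "{}"]
    by (auto simp: B_edges_explicit B_verts_explicit all_semi)
  moreover have "?x 2 3 \<or> ?x 8 5 \<or> ?x 7 9 \<or> link A1 \<in> F \<or> link B2 \<in> F"
    using not_closed[of 3 "{3, 4, 6, 8, 9}"] closed[of "{3, 4, 6, 8, 9}" "{}"]
    by (auto simp: B_edges_explicit B_verts_explicit all_semi)
  moreover have "?x 3 4 \<or> ?x 7 9 \<or> ?x 6 8 \<or> link A2 \<in> F \<or> link B1 \<in> F"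
    using not_closed[of 3 "{2, 3, 5, 7, 8}"] closed[of "{2, 3, 5, 7, 8}" "{}"]
    by (auto simp: B_edges_explicit B_verts_explicit all_semi)
  moreover have "?x 3 8 \<or> ?x 5 7 \<or> ?x 9 6 \<or> link A1 \<in> F \<or> link B1 \<in> F"
    using not_closed[of 3 "{2, 3, 4, 7, 9}"] closed[of "{2, 3, 4, 7, 9}" "{}"]
    by (auto simp: B_edges_explicit B_verts_explicit all_semi)
  ultimately have main: "(link A1 \<in> F \<longleftrightarrow> link A2 \<in> F) \<and> (link B1 \<in> F \<longleftrightarrow> link B2 \<in> F) \<and>
    (link A1 \<in> F \<and> link B1 \<in> F \<longrightarrow> \<not> ?x 3 4 \<and> \<not> ?x 2 7 \<and> \<not> ?x 9 6 \<and> \<not> ?x 8 5 \<or>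
      \<not> ?x 2 3 \<and> \<not> ?x 4 9 \<and> \<not> ?x 5 7 \<and> \<not> ?x 6 8)"
    by (rule B_two_factor)
  then show "link A1 \<in> F \<longleftrightarrow> link A2 \<in> F" "link B1 \<in> F \<longleftrightarrow> link B2 \<in> F"
    by blast+
  \<comment> \<open>With all four semiedges in use, the copy is covered by the paths 4-9-7-5 and
    2-3-8-6, or by 4-3-8-5 and 2-7-9-6; the first path of each pair joins the a-feet, the second the
    b-feet.\<close>
  have split: "closed_via {A1, A2} {4, 5, 7, 9} \<and> closed_via {B1, B2} {2, 3, 6, 8} \<or>
      closed_via {A1, A2} {3, 4, 5, 8} \<and> closed_via {B1, B2} {2, 6, 7, 9}"
    if "link A1 \<in> F" "link B1 \<in> F"
  proof -
    from main that consider "\<not> ?x 3 4 \<and> \<not> ?x 2 7 \<and> \<not> ?x 9 6 \<and> \<not> ?x 8 5"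
      | "\<not> ?x 2 3 \<and> \<not> ?x 4 9 \<and> \<not> ?x 5 7 \<and> \<not> ?x 6 8"
      by blast
    then show ?thesis
    proof cases
      case 1
      have "closed_via {A1, A2} {4, 5, 7, 9}"
        using 1 by (intro closed) (auto simp: B_edges_explicit all_semi)
      moreover have "closed_via {B1, B2} {2, 3, 6, 8}"
        using 1 by (intro closed) (auto simp: B_edges_explicit all_semi)
      ultimately show ?thesis by simp
    next
      case 2
      have "closed_via {A1, A2} {3, 4, 5, 8}"
        using 2 by (intro closed) (auto simp: B_edges_explicit all_semi)
      moreover have "closed_via {B1, B2} {2, 6, 7, 9}"
        using 2 by (intro closed) (auto simp: B_edges_explicit all_semi)
      ultimately show ?thesis by simp
    qed
  qed
  \<comment> \<open>If only one pair of semiedges is used, the entire copy serves as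
    \<open>S\<close>.\<close>
  have whole: "closed_via T B_verts" if "\<forall>s. link s \<in> F \<longrightarrow> s \<in> T" for T
    using that by (intro closed) (auto simp: B_edges_explicit B_verts_explicit)
  show "\<exists>S. 4 \<in> S \<and> 5 \<in> S \<and> closed_via {A1, A2} S" if "link A1 \<in> F"
  proof (cases "link B1 \<in> F")
    case True
    from split[OF that this] show ?thesis
      by (elim disjE conjE, intro exI[of _ "{4, 5, 7, 9}"], simp, intro exI[of _ "{3, 4, 5, 8}"], simp)
  next
    case False
    then have "closed_via {A1, A2} B_verts"
      using main by (intro whole) (simp add: all_semi)
    then show ?thesis
      by (intro exI[of _ B_verts]) (simp add: B_verts_explicit)
  qed
  show "\<exists>S. 2 \<in> S \<and> 6 \<in> S \<and> closed_via {B1, B2} S" if "link B1 \<in> F"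
  proof (cases "link A1 \<in> F")
    case True
    from split[OF this that] show ?thesis
      by (elim disjE conjE, intro exI[of _ "{2, 3, 6, 8}"], simp, intro exI[of _ "{2, 6, 7, 9}"], simp)
  next
    case False
    then have "closed_via {B1, B2} B_verts"
      using main by (intro whole) (simp add: all_semi)
    then show ?thesis
      by (intro exI[of _ B_verts]) (simp add: B_verts_explicit)
  qed
qed

end

section \<open>Positions and kept edges\<close>

lemma next_pos_less: "(j, i) \<in> positions Cs \<Longrightarrow> (j, next_pos Cs j i) \<in> positions Cs"
  by (auto simp: positions_def next_pos_def intro!: mod_less_divisor)

lemma next_pos_bij: "bij_betw (next_pos Cs j) {..<length (Cs ! j)} {..<length (Cs ! j)}"
  unfolding next_pos_def by (rule bij_betw_Suc_mod)

lemma next_pos_inject: "(j, i) \<in> positions Cs \<Longrightarrow> (j, i') \<in> positions Cs \<Longrightarrow>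
  next_pos Cs j i = next_pos Cs j i' \<longleftrightarrow> i = i'"
  using bij_betw_imp_inj_on[OF next_pos_bij, of Cs j] by (auto simp: positions_def inj_on_def)

text \<open>Needed for the semiblowup, where \<open>B2\<close> of a copy is joined to
  \<open>A2\<close> of the copy before it.\<close>

lemma positions_prev:
  assumes "(j, i) \<in> positions Cs"
  obtains i' where "(j, i') \<in> positions Cs" "next_pos Cs j i' = i"
proof -
  have "i \<in> next_pos Cs j ` {..<length (Cs ! j)}"
    using bij_betw_imp_surj_on[OF next_pos_bij, of Cs j] assms by (simp add: positions_def)
  then show ?thesis
    using assms that by (auto simp: positions_def)
qed

locale cycle_system =
  fixes G D :: "('v, 'e) pre_graph" and Cs :: "('v \<times> 'e) list list"
  assumes graph_G: "graph G" and cubic_G: "cubic G"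
    and subgraph: "subgraph D G" and disjoint: "disjoint_cycles D Cs"
begin

lemma Cs_cycle: "C \<in> set Cs \<Longrightarrow> is_cycle G C"
  using disjoint subgraph unfolding disjoint_cycles_def subgraph_def is_cycle_def
  by (metis subsetD)

lemma cyc_vertex_in_cycle: "(j, i) \<in> positions Cs \<Longrightarrow> fst (Cs ! j ! i) \<in> cycle_verts (Cs ! j)"
  by (auto simp: positions_def cycle_verts_def)

lemma cyc_vertex_in_verts:
  assumes "(j, i) \<in> positions Cs"
  shows "fst (Cs ! j ! i) \<in> verts G"
proof -
  have "is_cycle G (Cs ! j)"
    using assms by (intro Cs_cycle) (auto simp: positions_def)
  then show ?thesis
    using cycle_verts_subset[of G "Cs ! j"] graph_G cyc_vertex_in_cycle[OF assms]
    unfolding graph_def by blast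
qed

text \<open>Disjointness of the listed cycles fixes \<open>j\<close>, and distinctness of the
  vertices on one cycle then fixes \<open>i\<close>.\<close>

lemma cyc_vertex_inject:
  assumes "(j, i) \<in> positions Cs" "(j', i') \<in> positions Cs"
  shows "(cyc_vertex Cs j i :: 'v blow_vertex) = cyc_vertex Cs j' i' \<longleftrightarrow> j = j' \<and> i = i'"
proof -
  have "j = j' \<and> i = i'" if eq: "fst (Cs ! j ! i) = fst (Cs ! j' ! i')"
  proof -
    have j: "j = j'"
      using disjoint assms cyc_vertex_in_cycle[OF assms(1)] cyc_vertex_in_cycle[OF assms(2)] eq
      by (fastforce simp: disjoint_cycles_def positions_def)
    have "is_cycle G (Cs ! j)"
      using assms by (intro Cs_cycle) (auto simp: positions_def)
    then have "distinct (map fst (Cs ! j))"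
      by (simp add: is_cycle_def)
    then have "i = i'"
      using eq assms nth_eq_iff_index_eq[of "map fst (Cs ! j)" i i'] by (auto simp: positions_def j)
    with j show ?thesis by simp
  qed
  then show ?thesis
    by (auto simp: cyc_vertex_def)
qed

text \<open>The cycle of \<open>D\<close> through the vertex takes two of its three edge ends in
  \<open>G\<close>, and its edges are not kept.\<close>

lemma kept_degree:
  assumes "(j, i) \<in> positions Cs"
  shows "(\<Sum>e\<in>kept_edges G Cs. count (blow_ends G e) (cyc_vertex Cs j i)) \<le> 1"
proof -
  define v where "v = fst (Cs ! j ! i)"
  have count_Orig: "count (image_mset Orig M) (Orig v) = count M v" for M
    by (induction M) auto
  let ?D = "\<Union>C\<in>set Cs. cycle_edges C"
  have j: "Cs ! j \<in> set Cs"
    using assms by (auto simp: positions_def)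
  have fin: "finite (edges G)" and "?D \<subseteq> edges G"
    using graph_G Cs_cycle cycle_edges_subset by (auto simp: graph_def)
  have "2 = (\<Sum>e\<in>cycle_edges (Cs ! j). count (ends G e) v)"
    using cycle_degree[OF Cs_cycle[OF j] cyc_vertex_in_cycle[OF assms]] by (simp add: v_def)
  also have "\<dots> \<le> (\<Sum>e\<in>?D. count (ends G e) v)"
    using j \<open>?D \<subseteq> edges G\<close> finite_subset[OF _ fin] by (intro sum_mono2) auto
  finally have "2 + (\<Sum>e\<in>edges G - ?D. count (ends G e) v) \<le>
     (\<Sum>e\<in>?D. count (ends G e) v) + (\<Sum>e\<in>edges G - ?D. count (ends G e) v)"
    by simp
  also have "\<dots> = degree G v"
    using sum.subset_diff[OF \<open>?D \<subseteq> edges G\<close> fin, of "\<lambda>e. count (ends G e) v"] by (simp add: degree_def)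
  also have "\<dots> = 3"
    using cubic_G cyc_vertex_in_verts[OF assms] by (simp add: regular_def v_def)
  finally have "(\<Sum>e\<in>edges G - ?D. count (ends G e) v) \<le> 1"
    by simp
  moreover have "(\<Sum>e\<in>kept_edges G Cs. count (blow_ends G e) (cyc_vertex Cs j i)) =
     (\<Sum>e\<in>edges G - ?D. count (ends G e) v)"
    unfolding kept_edges_def
    by (subst sum.reindex) (auto simp: inj_on_def cyc_vertex_def count_Orig simp flip: v_def)
  ultimately show ?thesis by simp
qed

text \<open>\<open>e1\<close> and \<open>e2\<close> stand for the two new edges at the cycle vertex.
  Of the two edge ends that \<open>K\<close> has there, kept edges supply at most one by
  \<open>kept_degree\<close>, so a new edge is used; if both are, nothing is left for kept
  edges.\<close>

lemma uses_new_edge: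
  assumes pos: "(j, i) \<in> positions Cs" and K: "is_cycle H K" and ends: "ends H = blow_ends G"
    and v: "cyc_vertex Cs j i \<in> cycle_verts K"
    and inc: "\<And>e. e \<in> edges H \<Longrightarrow> cyc_vertex Cs j i \<in># blow_ends G e \<Longrightarrow> e \<in> kept_edges G Cs \<union> {e1, e2}"
    and ne: "e1 \<noteq> e2" "e1 \<notin> kept_edges G Cs" "e2 \<notin> kept_edges G Cs"
    and count: "count (blow_ends G e1) (cyc_vertex Cs j i) = 1" "count (blow_ends G e2) (cyc_vertex Cs j i) = 1"
  shows uses_new_edge_disj: "e1 \<in> cycle_edges K \<or> e2 \<in> cycle_edges K"
    and uses_new_edges_only: "e1 \<in> cycle_edges K \<Longrightarrow> e2 \<in> cycle_edges K \<Longrightarrow>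
      e \<in> cycle_edges K \<Longrightarrow> cyc_vertex Cs j i \<in># blow_ends G e \<Longrightarrow> e = e1 \<or> e = e2"
proof -
  let ?F = "cycle_edges K" and ?c = "\<lambda>e. count (blow_ends G e) (cyc_vertex Cs j i)"
  have fin: "finite ?F"
    by (simp add: cycle_edges_def)
  have fin_kept: "finite (kept_edges G Cs)"
    using graph_G by (simp add: kept_edges_def graph_def)
  have "2 = sum ?c ?F"
    using cycle_degree[OF K v] by (simp add: ends)
  also have "\<dots> = sum ?c (?F \<inter> kept_edges G Cs \<union> ?F \<inter> {e1, e2})"
  proof (rule sum.mono_neutral_right)
    show "\<forall>e\<in>?F - (?F \<inter> kept_edges G Cs \<union> ?F \<inter> {e1, e2}). ?c e = 0"
      using inc cycle_edges_subset[OF K] by (auto simp flip: not_in_iff)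
  qed (use fin in auto)
  also have "\<dots> = sum ?c (?F \<inter> kept_edges G Cs) + sum ?c (?F \<inter> {e1, e2})"
    using ne fin by (intro sum.union_disjoint) auto
  finally have sum2: "sum ?c (?F \<inter> kept_edges G Cs) + sum ?c (?F \<inter> {e1, e2}) = 2"
    by simp
  have "sum ?c (?F \<inter> kept_edges G Cs) \<le> sum ?c (kept_edges G Cs)"
    using fin_kept by (intro sum_mono2) auto
  also have "\<dots> \<le> 1"
    by (rule kept_degree[OF pos])
  finally have "sum ?c (?F \<inter> {e1, e2}) \<noteq> 0"
    using sum2 by linarith
  then show "e1 \<in> ?F \<or> e2 \<in> ?F"
    by (metis Int_insert_right_if0 Int_empty_right sum.empty)
  assume e12: "e1 \<in> ?F" "e2 \<in> ?F" and e: "e \<in> ?F" "cyc_vertex Cs j i \<in># blow_ends G e"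
  have "sum ?c (?F \<inter> {e1, e2}) = 2"
    using e12 ne count by simp
  then have "sum ?c (?F \<inter> kept_edges G Cs) = 0"
    using sum2 by simp
  then have zero: "?c e = 0" if "e \<in> ?F \<inter> kept_edges G Cs" for e
    using that fin by simp
  have "?c e \<noteq> 0"
    using e(2) by simp
  with zero[of e] have "e \<notin> ?F \<inter> kept_edges G Cs"
    by (rule contrapos_nn[rotated])
  then have "e \<notin> kept_edges G Cs"
    using e(1) by simp
  moreover have "e \<in> edges H"
    using e(1) cycle_edges_subset[OF K] by blast
  ultimately show "e = e1 \<or> e = e2"
    using inc[of e] e(2) by simp
qed

end

section \<open>Three consecutive covered parts\<close>

lemma cycle_edge_ends:
  assumes "is_cycle G C" "e \<in> cycle_edges C"
  shows "set_mset (ends G e) \<subseteq> cycle_verts C"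
proof -
  obtain k where k: "k < length C" "e = snd (C ! k)"
    using assms(2) by (auto simp: cycle_edges_def in_set_conv_nth)
  moreover have "Suc k mod length C < length C"
    using k by (intro mod_less_divisor) auto
  ultimately show ?thesis
    using assms(1) by (auto simp: is_cycle_def cycle_verts_def)
qed

section \<open>Edges of the two constructions, seen from a copy of the pole\<close>

lemma semiblowup_edgeE:
  assumes "e \<in> edges (semiblowup G Cs)"
  obtains "e \<in> kept_edges G Cs"
  | j i s where "(j, i) \<in> positions Cs" "s \<in> B_edges" "e = B_edge j i s"
  | j i where "(j, i) \<in> positions Cs" "e = NewE {#cyc_vertex Cs j i, semi j i B1#}"
  | j i where "(j, i) \<in> positions Cs" "e = NewE {#semi j i A2, semi j (next_pos Cs j i) B2#}"
  | j i where "(j, i) \<in> positions Cs" "e = NewE {#semi j i A1, cyc_vertex Cs j (next_pos Cs j i)#}"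
  using assms that unfolding semiblowup_def B_copies_edges_def B_edge_def
  by (auto simp: Let_def)

lemma blowup_edgeE:
  assumes "e \<in> edges (blowup G Cs)"
  obtains "e \<in> kept_edges G Cs"
  | j i s where "(j, i) \<in> positions Cs" "s \<in> B_edges" "e = B_edge j i s"
  | j i where "(j, i) \<in> positions Cs" "e = NewE {#cyc_vertex Cs j i, U j i#}"
  | j i where "(j, i) \<in> positions Cs" "e = NewE {#cyc_vertex Cs j i, W j i#}"
  | j i where "(j, i) \<in> positions Cs" "e = NewE {#U j i, semi j i B1#}"
  | j i where "(j, i) \<in> positions Cs" "e = NewE {#W j i, semi j i B2#}"
  | j i where "(j, i) \<in> positions Cs" "e = NewE {#semi j i A1, U j (next_pos Cs j i)#}"
  | j i where "(j, i) \<in> positions Cs" "e = NewE {#semi j i A2, W j (next_pos Cs j i)#}"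
  using assms that unfolding blowup_def B_copies_edges_def B_edge_def
  by (auto simp: Let_def)

lemma ends_semiblowup: "ends (semiblowup G Cs) = blow_ends G"
  by (simp add: semiblowup_def)

lemma ends_blowup: "ends (blowup G Cs) = blow_ends G"
  by (simp add: blowup_def)

lemma set_mset_kept: "e \<in> kept_edges G Cs \<Longrightarrow> set_mset (blow_ends G e) \<subseteq> range Orig"
  by (auto simp: kept_edges_def)

lemma NewE_not_kept: "NewE s \<notin> kept_edges G Cs"
  by (auto simp: kept_edges_def)

text \<open>\<open>p\<close> is meant to be the position before \<open>i\<close>, whose copy
  receives the semiedge \<open>B2\<close>.\<close>

definition semiblowup_far :: "('v \<times> 'e) list list \<Rightarrow> nat \<Rightarrow> nat \<Rightarrow> nat \<Rightarrow> semiedge \<Rightarrow> 'v blow_vertex" where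
  "semiblowup_far Cs j p i s = (case s of A1 \<Rightarrow> cyc_vertex Cs j (next_pos Cs j i)
    | A2 \<Rightarrow> semi j (next_pos Cs j i) B2 | B1 \<Rightarrow> cyc_vertex Cs j i | B2 \<Rightarrow> semi j p A2)"

definition blowup_far :: "('v \<times> 'e) list list \<Rightarrow> nat \<Rightarrow> nat \<Rightarrow> semiedge \<Rightarrow> 'v blow_vertex" where
  "blowup_far Cs j i s = (case s of A1 \<Rightarrow> U j (next_pos Cs j i)
    | A2 \<Rightarrow> W j (next_pos Cs j i) | B1 \<Rightarrow> U j i | B2 \<Rightarrow> W j i)"

lemma cycle_through_B_semiblowup:
  fixes Cs :: "('v \<times> 'e) list list"
  assumes K: "is_cycle (semiblowup G Cs) K"
    and pos: "(j, p) \<in> positions Cs" "(j, i) \<in> positions Cs" "next_pos Cs j p = i"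
  shows "cycle_through_B (semiblowup G Cs) K G j i (semiblowup_far Cs j p i)"
proof
  let ?link = "\<lambda>s. NewE {#semi j i s, semiblowup_far Cs j p i s#} :: ('v, 'e) blow_edge"
  fix e :: "('v, 'e) blow_edge" and q assume e: "e \<in> edges (semiblowup G Cs)" "InB j i q \<in># blow_ends G e"
  from e(1)
  show "(\<exists>s\<in>B_edges. q \<in># s \<and> e = B_edge j i s) \<or> (\<exists>s. foot s = q \<and> e = ?link s)"
  proof (cases rule: semiblowup_edgeE)
    case 1
    then show ?thesis using e set_mset_kept by fastforce
  next
    case (2 j' i' s)
    then show ?thesis using e by (auto simp: B_edge_def)
  next
    case (3 j' i')
    then have "foot B1 = q \<and> e = ?link B1"
      using e by (auto simp: semi_def cyc_vertex_def semiblowup_far_def add_mset_commute)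
    then show ?thesis by blast
  next
    case (4 j' i')
    \<comment> \<open>One kind of edge plays two roles: it is the link of \<open>A2\<close> if
      \<open>i' = i\<close>, and that of \<open>B2\<close> if \<open>i\<close> is the position after
      \<open>i'\<close>, which forces \<open>i' = p\<close>. On a cycle of length 1 it is
      both.\<close>
    then have "foot A2 = q \<and> e = ?link A2 \<or> foot B2 = q \<and> e = ?link B2"
      using e pos next_pos_inject[of j p Cs i']
      by (auto simp: semi_def semiblowup_far_def add_mset_commute)
    then show ?thesis by blast
  next
    case (5 j' i')
    then have "foot A1 = q \<and> e = ?link A1"
      using e by (auto simp: semi_def cyc_vertex_def semiblowup_far_def)
    then show ?thesis by blast
  qed
next
  \<comment> \<open>Only \<open>A2\<close> and \<open>B2\<close> are connected to copy vertices.
    Their feet 5 and 6 are distinct and not adjacent in \<open>B\<close>.\<close>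
  fix s q assume "semiblowup_far Cs j p i s = InB j i q"
  then show "q \<noteq> foot s \<and> {#foot s, q#} \<notin> B_edges"
    by (cases s) (auto simp: semiblowup_far_def cyc_vertex_def semi_def B_edges_explicit pair_mset_eq_iff)
qed (use K in \<open>simp_all add: ends_semiblowup\<close>)

lemma cycle_through_B_blowup:
  fixes Cs :: "('v \<times> 'e) list list"
  assumes K: "is_cycle (blowup G Cs) K" and pos: "(j, i) \<in> positions Cs"
  shows "cycle_through_B (blowup G Cs) K G j i (blowup_far Cs j i)"
proof
  let ?link = "\<lambda>s. NewE {#semi j i s, blowup_far Cs j i s#} :: ('v, 'e) blow_edge"
  fix e :: "('v, 'e) blow_edge" and q assume e: "e \<in> edges (blowup G Cs)" "InB j i q \<in># blow_ends G e"
  from e(1)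
  show "(\<exists>s\<in>B_edges. q \<in># s \<and> e = B_edge j i s) \<or> (\<exists>s. foot s = q \<and> e = ?link s)"
  proof (cases rule: blowup_edgeE)
    case 1
    then show ?thesis using e set_mset_kept by fastforce
  next
    case (2 j' i' s)
    then show ?thesis using e by (auto simp: B_edge_def)
  next
    case (5 j' i')
    then have "foot B1 = q \<and> e = ?link B1"
      using e by (auto simp: semi_def blowup_far_def add_mset_commute)
    then show ?thesis by blast
  next
    case (6 j' i')
    then have "foot B2 = q \<and> e = ?link B2"
      using e by (auto simp: semi_def blowup_far_def add_mset_commute)
    then show ?thesis by blast
  next
    case (7 j' i')
    then have "foot A1 = q \<and> e = ?link A1"
      using e by (auto simp: semi_def blowup_far_def)
    then show ?thesis by blast
  next
    case (8 j' i')
    then have "foot A2 = q \<and> e = ?link A2"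
      using e by (auto simp: semi_def blowup_far_def)
    then show ?thesis by blast
  qed (use e in \<open>auto simp: cyc_vertex_def\<close>)
next
  \<comment> \<open>Vacuous, since all four semiedges end at \<open>U\<close> or \<open>W\<close>
    vertices.\<close>
  fix s q assume "blowup_far Cs j i s = InB j i q"
  then show "q \<noteq> foot s \<and> {#foot s, q#} \<notin> B_edges"
    by (cases s) (auto simp: blowup_far_def)
qed (use K in \<open>simp_all add: ends_blowup\<close>)

section \<open>Closing up around a covered triple\<close>

context cycle_system
begin

lemma semiblowup_covered:
  assumes K: "is_cycle (semiblowup G Cs) K" and pos: "(j, i) \<in> positions Cs"
    and i': "i' = next_pos Cs j i"
    and cov: "InB j i ` B_verts \<subseteq> cycle_verts K" "InB j i' ` B_verts \<subseteq> cycle_verts K"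
    and v: "cyc_vertex Cs j i' \<in> cycle_verts K"
  shows "cycle_verts K \<inter> range Orig \<subseteq> {cyc_vertex Cs j i'}"
proof -
  let ?F = "cycle_edges K" and ?v = "cyc_vertex Cs j i' :: 'v blow_vertex"
  define a1 where "a1 = (NewE {#semi j i A1, ?v#} :: ('v, 'e) blow_edge)"
  define b1 where "b1 = (NewE {#semi j i' B1, ?v#} :: ('v, 'e) blow_edge)"
  define ab where "ab = (NewE {#semi j i A2, semi j i' B2#} :: ('v, 'e) blow_edge)"
  note defs = a1_def b1_def ab_def
  have pos': "(j, i') \<in> positions Cs"
    using pos next_pos_less i' by simp
  obtain p where p: "(j, p) \<in> positions Cs" "next_pos Cs j p = i"
    using positions_prev[OF pos] .
  interpret a: cycle_through_B "semiblowup G Cs" K G j i "semiblowup_far Cs j p i"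
    using cycle_through_B_semiblowup[OF K p(1) pos p(2)] .
  interpret b: cycle_through_B "semiblowup G Cs" K G j i' "semiblowup_far Cs j i i'"
    using cycle_through_B_semiblowup[OF K pos pos' i'[symmetric]] .
  have links: "a.link A1 = a1" "a.link A2 = ab" "b.link B1 = b1" "b.link B2 = ab"
    by (auto simp: defs semiblowup_far_def i' add_mset_commute)
  have v_notin: "?v \<notin> range (InB j k)" for k
    by (auto simp: cyc_vertex_def)
  have A: "a1 \<in> ?F \<longleftrightarrow> ab \<in> ?F" and B: "b1 \<in> ?F \<longleftrightarrow> ab \<in> ?F"
    using a.covered_A[OF cov(1) v v_notin] b.covered_B[OF cov(2) v v_notin] by (simp_all only: links)
  have inc: "e \<in> kept_edges G Cs \<union> {a1, b1}"
    if "e \<in> edges (semiblowup G Cs)" "?v \<in># blow_ends G e" for e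
    using that(1)
  proof (cases rule: semiblowup_edgeE)
    case (3 l k)
    then have "l = j \<and> k = i'"
      using that(2) cyc_vertex_inject[OF pos' 3(1)] by (auto simp: semi_def cyc_vertex_def)
    then show ?thesis using 3 by (simp add: defs add_mset_commute)
  next
    case (5 l k)
    then have "l = j \<and> next_pos Cs l k = i'"
      using that(2) cyc_vertex_inject[OF pos' next_pos_less[OF 5(1)]] by (auto simp: semi_def cyc_vertex_def)
    then have "l = j \<and> k = i"
      using next_pos_inject[OF pos, of k] 5(1) by (auto simp: i')
    then show ?thesis using 5 by (simp add: defs i')
  qed (use that(2) in \<open>auto simp: B_edge_def semi_def cyc_vertex_def\<close>)
  have "a1 \<noteq> b1"
    by (auto simp: defs semi_def)
  moreover have "a1 \<notin> kept_edges G Cs" "b1 \<notin> kept_edges G Cs"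
    by (auto simp: defs NewE_not_kept)
  moreover have "count (blow_ends G a1) ?v = 1" "count (blow_ends G b1) ?v = 1"
    by (auto simp: defs semi_def cyc_vertex_def)
  ultimately have "a1 \<in> ?F \<or> b1 \<in> ?F" and
    only: "a1 \<in> ?F \<Longrightarrow> b1 \<in> ?F \<Longrightarrow> e \<in> ?F \<Longrightarrow> ?v \<in># blow_ends G e \<Longrightarrow> e = a1 \<or> e = b1" for e
    using uses_new_edge[OF pos' K ends_semiblowup v inc] by blast+
  with A B have F: "a1 \<in> ?F" "b1 \<in> ?F" "ab \<in> ?F"
    by blast+
  \<comment> \<open>\<open>S\<close> contains the part of \<open>K\<close> between the feet 4 and 5
    of the first copy, \<open>T\<close> that between the feet 2 and 6 of the second.\<close>
  obtain S where S: "4 \<in> S" "5 \<in> S" "a.closed_via {A1, A2} S"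
    using a.covered_closed_A[OF cov(1) v v_notin] F by (auto simp: links)
  obtain T where T: "2 \<in> T" "6 \<in> T" "b.closed_via {B1, B2} T"
    using b.covered_closed_B[OF cov(2) v v_notin] F by (auto simp: links)
  let ?Y = "InB j i ` S \<union> InB j i' ` T \<union> {?v}"
  have new: "set_mset (blow_ends G e) \<subseteq> ?Y" if "e \<in> {a1, b1, ab}" for e
    using that S T by (auto simp: defs semi_def)
  have "cycle_verts K \<subseteq> ?Y"
  proof (rule cycle_connected[OF K v])
    fix e assume e: "e \<in> ?F" "set_mset (ends (semiblowup G Cs) e) \<inter> ?Y \<noteq> {}"
    then consider "set_mset (blow_ends G e) \<inter> InB j i ` S \<noteq> {}"
      | "set_mset (blow_ends G e) \<inter> InB j i' ` T \<noteq> {}" | "?v \<in># blow_ends G e"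
      by (auto simp: ends_semiblowup)
    then have "set_mset (blow_ends G e) \<subseteq> ?Y"
    proof cases
      case 1
      then have "set_mset (blow_ends G e) \<subseteq> InB j i ` S \<or> e \<in> {a1, ab}"
        using S(3)[unfolded a.closed_via_def] e(1) by (auto simp: links)
      then show ?thesis using new[of e] by blast
    next
      case 2
      then have "set_mset (blow_ends G e) \<subseteq> InB j i' ` T \<or> e \<in> {b1, ab}"
        using T(3)[unfolded b.closed_via_def] e(1) by (auto simp: links)
      then show ?thesis using new[of e] by blast
    next
      case 3
      then have "e = a1 \<or> e = b1"
        using only F e(1) by blast
      then show ?thesis using new[of e] by blast
    qed
    then show "set_mset (ends (semiblowup G Cs) e) \<subseteq> ?Y"
      by (simp add: ends_semiblowup)
  qed auto
  then show ?thesis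
    by auto
qed

text \<open>If \<open>u\<close> is used, the vertex \<open>U\<close> continues along exactly one of
  \<open>a1\<close> and \<open>b1\<close>; the pairing of semiedges transfers this choice to
  \<open>W\<close>, so \<open>w\<close> is used as well. The same holds with \<open>u\<close> and
  \<open>w\<close> exchanged. Thus \<open>K\<close> closes up through one pair of semiedges.\<close>

lemma blowup_covered:
  assumes K: "is_cycle (blowup G Cs) K" and pos: "(j, i) \<in> positions Cs"
    and i': "i' = next_pos Cs j i"
    and cov: "InB j i ` B_verts \<subseteq> cycle_verts K" "InB j i' ` B_verts \<subseteq> cycle_verts K"
    and v: "cyc_vertex Cs j i' \<in> cycle_verts K"
  shows "cycle_verts K \<inter> range Orig \<subseteq> {cyc_vertex Cs j i'}"
proof -
  let ?F = "cycle_edges K" and ?v = "cyc_vertex Cs j i' :: 'v blow_vertex"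
  define a1 where "a1 = (NewE {#semi j i A1, U j i'#} :: ('v, 'e) blow_edge)"
  define a2 where "a2 = (NewE {#semi j i A2, W j i'#} :: ('v, 'e) blow_edge)"
  define b1 where "b1 = (NewE {#semi j i' B1, U j i'#} :: ('v, 'e) blow_edge)"
  define b2 where "b2 = (NewE {#semi j i' B2, W j i'#} :: ('v, 'e) blow_edge)"
  define u where "u = (NewE {#?v, U j i'#} :: ('v, 'e) blow_edge)"
  define w where "w = (NewE {#?v, W j i'#} :: ('v, 'e) blow_edge)"
  note defs = a1_def a2_def b1_def b2_def u_def w_def semi_def cyc_vertex_def
  have pos': "(j, i') \<in> positions Cs"
    using pos next_pos_less i' by simp
  interpret a: cycle_through_B "blowup G Cs" K G j i "blowup_far Cs j i"
    using cycle_through_B_blowup[OF K pos] .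
  interpret b: cycle_through_B "blowup G Cs" K G j i' "blowup_far Cs j i'"
    using cycle_through_B_blowup[OF K pos'] .
  have links: "a.link A1 = a1" "a.link A2 = a2" "b.link B1 = b1" "b.link B2 = b2"
    by (auto simp: defs blowup_far_def i')
  have v_notin: "?v \<notin> range (InB j k)" for k
    by (auto simp: cyc_vertex_def)
  have A: "a1 \<in> ?F \<longleftrightarrow> a2 \<in> ?F" and B: "b1 \<in> ?F \<longleftrightarrow> b2 \<in> ?F"
    using a.covered_A[OF cov(1) v v_notin] b.covered_B[OF cov(2) v v_notin] by (simp_all only: links)
  have inc_v: "e \<in> kept_edges G Cs \<union> {u, w}"
    if "e \<in> edges (blowup G Cs)" "?v \<in># blow_ends G e" for e
    using that(1)
  proof (cases rule: blowup_edgeE)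
    case (3 l k)
    then have "l = j \<and> k = i'"
      using that(2) cyc_vertex_inject[OF pos' 3(1)] by (auto simp: cyc_vertex_def)
    then show ?thesis using 3 by (simp add: defs)
  next
    case (4 l k)
    then have "l = j \<and> k = i'"
      using that(2) cyc_vertex_inject[OF pos' 4(1)] by (auto simp: cyc_vertex_def)
    then show ?thesis using 4 by (simp add: defs)
  qed (use that(2) in \<open>auto simp: B_edge_def semi_def cyc_vertex_def\<close>)
  have inc_u: "e \<in> {u, a1, b1}" if "e \<in> edges (blowup G Cs)" "U j i' \<in># blow_ends G e" for e
    using that(1)
  proof (cases rule: blowup_edgeE)
    case 1
    then show ?thesis using that(2) set_mset_kept by fastforce
  next
    case (7 l k)
    then have "l = j \<and> k = i"
      using that(2) next_pos_inject[OF pos, of k] by (auto simp: semi_def i')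
    then show ?thesis using 7 by (simp add: defs i')
  qed (use that(2) in \<open>auto simp: B_edge_def defs add_mset_commute\<close>)
  have inc_w: "e \<in> {w, a2, b2}" if "e \<in> edges (blowup G Cs)" "W j i' \<in># blow_ends G e" for e
    using that(1)
  proof (cases rule: blowup_edgeE)
    case 1
    then show ?thesis using that(2) set_mset_kept by fastforce
  next
    case (8 l k)
    then have "l = j \<and> k = i"
      using that(2) next_pos_inject[OF pos, of k] by (auto simp: semi_def i')
    then show ?thesis using 8 by (simp add: defs i')
  qed (use that(2) in \<open>auto simp: B_edge_def defs add_mset_commute\<close>)
  have "u \<noteq> w" "u \<notin> kept_edges G Cs" "w \<notin> kept_edges G Cs"
    "count (blow_ends G u) ?v = 1" "count (blow_ends G w) ?v = 1"
    by (auto simp: defs NewE_not_kept add_eq_conv_diff)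
  then have uw: "u \<in> ?F \<or> w \<in> ?F" and
    only: "u \<in> ?F \<Longrightarrow> w \<in> ?F \<Longrightarrow> e \<in> ?F \<Longrightarrow> ?v \<in># blow_ends G e \<Longrightarrow> e = u \<or> e = w" for e
    using uses_new_edge[OF pos' K ends_blowup v inc_v] by blast+
  have two_u: "two_of (u \<in> ?F) (a1 \<in> ?F) (b1 \<in> ?F)" if "U j i' \<in> cycle_verts K"
    by (rule two_of_incident[OF K that], rule inc_u) (auto simp: ends_blowup defs pair_mset_eq_iff)
  have two_w: "two_of (w \<in> ?F) (a2 \<in> ?F) (b2 \<in> ?F)" if "W j i' \<in> cycle_verts K"
    by (rule two_of_incident[OF K that], rule inc_w) (auto simp: ends_blowup defs pair_mset_eq_iff)
  \<comment> \<open>The new vertices are not assumed to lie on \<open>K\<close>; an edge of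
    \<open>K\<close> at them puts them there.\<close>
  have end_u: "U j i' \<in> cycle_verts K" if "u \<in> ?F \<or> a1 \<in> ?F \<or> b1 \<in> ?F"
    using that cycle_edge_ends[OF K, of u] cycle_edge_ends[OF K, of a1] cycle_edge_ends[OF K, of b1]
    by (auto simp: ends_blowup defs)
  have end_w: "W j i' \<in> cycle_verts K" if "w \<in> ?F \<or> a2 \<in> ?F \<or> b2 \<in> ?F"
    using that cycle_edge_ends[OF K, of w] cycle_edge_ends[OF K, of a2] cycle_edge_ends[OF K, of b2]
    by (auto simp: ends_blowup defs)
  have F: "u \<in> ?F" "w \<in> ?F" and xor: "a1 \<in> ?F \<and> a2 \<in> ?F \<and> b1 \<notin> ?F \<and> b2 \<notin> ?F \<or> a1 \<notin> ?F \<and> a2 \<notin> ?F \<and> b1 \<in> ?F \<and> b2 \<in> ?F"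
    using uw two_u two_w end_u end_w A B unfolding two_of_iff by blast+
  \<comment> \<open>Shared by the two cases of \<open>xor\<close>: \<open>S\<close> is the traversed
    part of copy \<open>k\<close>, and \<open>N\<close> contains the connecting edges that
    \<open>K\<close> uses.\<close>
  have local: "cycle_verts K \<inter> range Orig \<subseteq> {?v}"
    if S: "\<And>e. e \<in> ?F \<Longrightarrow> set_mset (blow_ends G e) \<inter> InB j k ` S \<noteq> {} \<Longrightarrow>
        set_mset (blow_ends G e) \<subseteq> InB j k ` S \<or> e \<in> N"
      and N: "{u, w} \<union> ?F \<inter> {a1, a2, b1, b2} \<subseteq> N"
        "\<And>e. e \<in> N \<Longrightarrow> set_mset (blow_ends G e) \<subseteq> InB j k ` S \<union> {?v, U j i', W j i'}"
    for S N k
  proof -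
    let ?Y = "InB j k ` S \<union> {?v, U j i', W j i'}"
    have "cycle_verts K \<subseteq> ?Y"
    proof (rule cycle_connected[OF K v])
      fix e assume e: "e \<in> ?F" "set_mset (ends (blowup G Cs) e) \<inter> ?Y \<noteq> {}"
      then have "e \<in> edges (blowup G Cs)"
        using cycle_edges_subset[OF K] by blast
      note inc = inc_u[OF this] inc_w[OF this]
      consider "set_mset (blow_ends G e) \<inter> InB j k ` S \<noteq> {}"
        | "?v \<in># blow_ends G e" | "U j i' \<in># blow_ends G e" | "W j i' \<in># blow_ends G e"
        using e(2) by (auto simp: ends_blowup)
      then have "set_mset (blow_ends G e) \<subseteq> InB j k ` S \<or> e \<in> N"
      proof cases
        case 1
        then show ?thesis
          using S e(1) by blast
      next
        case 2
        then show ?thesis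
          using only[OF F e(1)] N(1) by auto
      next
        case 3
        then show ?thesis
          using inc(1) e(1) N(1) by auto
      next
        case 4
        then show ?thesis
          using inc(2) e(1) N(1) by auto
      qed
      then show "set_mset (ends (blowup G Cs) e) \<subseteq> ?Y"
        using N(2)[of e] by (auto simp: ends_blowup)
    qed auto
    then show ?thesis
      by auto
  qed
  from xor show ?thesis
  proof (elim disjE conjE)
    assume ab: "a1 \<in> ?F" "a2 \<in> ?F" "b1 \<notin> ?F" "b2 \<notin> ?F"
    obtain S where S: "4 \<in> S" "5 \<in> S" "a.closed_via {A1, A2} S"
      using a.covered_closed_A[OF cov(1) v v_notin] ab by (auto simp: links)
    show ?thesis
    proof (rule local[where N = "{u, w, a1, a2}"])
      fix e assume "e \<in> ?F" "set_mset (blow_ends G e) \<inter> InB j i ` S \<noteq> {}"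
      then show "set_mset (blow_ends G e) \<subseteq> InB j i ` S \<or> e \<in> {u, w, a1, a2}"
        using S(3)[unfolded a.closed_via_def] by (auto simp: links)
    qed (use ab S in \<open>auto simp: defs\<close>)
  next
    assume ab: "a1 \<notin> ?F" "a2 \<notin> ?F" "b1 \<in> ?F" "b2 \<in> ?F"
    obtain S where S: "2 \<in> S" "6 \<in> S" "b.closed_via {B1, B2} S"
      using b.covered_closed_B[OF cov(2) v v_notin] ab by (auto simp: links)
    show ?thesis
    proof (rule local[where N = "{u, w, b1, b2}"])
      fix e assume "e \<in> ?F" "set_mset (blow_ends G e) \<inter> InB j i' ` S \<noteq> {}"
      then show "set_mset (blow_ends G e) \<subseteq> InB j i' ` S \<or> e \<in> {u, w, b1, b2}"
        using S(3)[unfolded b.closed_via_def] by (auto simp: links)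
    qed (use ab S in \<open>auto simp: defs\<close>)
  qed
qed

end

section \<open>Counting missed vertices\<close>

text \<open>\<open>circ\<close> is meaningful only if a cycle exists. A shortest walk between the
  ends of \<open>e\<close> that avoids \<open>e\<close> is a path, and \<open>e\<close> closes it;
  if \<open>e\<close> is a loop, the walk is empty and \<open>e\<close> alone is the cycle.\<close>

lemma ex_cycle_through_edge:
  assumes "graph G" "edge_connected 2 G" "e \<in> edges G"
  shows "\<exists>C. is_cycle G C"
proof -
  have size: "size (ends G e) = Suc 1" and sub: "set_mset (ends G e) \<subseteq> verts G"
    using assms by (auto simp: graph_def)
  obtain a M where "ends G e = add_mset a M" "size M = 1"
    using size by (cases "ends G e") auto
  moreover from this obtain b where "M = {#b#}"
    using size_1_singleton_mset by blast
  ultimately have e: "ends G e = {#a, b#}" and ab: "a \<in> verts G" "b \<in> verts G"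
    using sub by auto
  let ?R = "adjacency (delete_edges G {e})"
  have "connected_graph (delete_edges G {e})"
    using assms(2,3) unfolding edge_connected_def by (metis card.empty card_insert_disjoint empty_iff
      empty_subsetI finite.emptyI insert_subset lessI numeral_2_eq_2)
  then have "(b, a) \<in> ?R\<^sup>*"
    using ab by (simp add: connected_graph_def delete_edges_def)
  then have ex: "\<exists>n. (b, a) \<in> ?R ^^ n"
    by (simp add: rtrancl_power)
  define n where "n = (LEAST n. (b, a) \<in> ?R ^^ n)"
  have n: "(b, a) \<in> ?R ^^ n" and least: "\<And>m. (b, a) \<in> ?R ^^ m \<Longrightarrow> n \<le> m"
    using ex by (auto simp: n_def intro: LeastI_ex Least_le)
  from n obtain f where f: "f 0 = b" "f n = a" "\<And>i. i < n \<Longrightarrow> (f i, f (Suc i)) \<in> ?R"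
    by (auto simp: relpow_fun_conv)
  have sub: "(f i, f (i + l)) \<in> ?R ^^ l" if "i + l \<le> n" for i l
    using that f(3) by (auto simp: relpow_fun_conv intro!: exI[of _ "\<lambda>k. f (i + k)"])
  have "f i \<noteq> f k" if "i < k" "k \<le> n" for i k
  proof
    assume eq: "f i = f k"
    have "(b, f i) \<in> ?R ^^ i" "(f k, a) \<in> ?R ^^ (n - k)"
      using sub[of 0 i] sub[of k "n - k"] that f(1,2) by simp_all
    \<comment> \<open>Cutting out the part between two visits to a vertex leaves a walk of length
      \<open>i + (n - k) < n\<close>.\<close>
    then have "(b, a) \<in> ?R ^^ (i + (n - k))"
      by (auto simp: relpow_add eq)
    then show False
      using least that by fastforce
  qed
  then have inj: "f i = f k \<longleftrightarrow> i = k" if "i \<le> n" "k \<le> n" for i k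
    using that by (metis linorder_neqE_nat)
  have "\<forall>i<n. \<exists>d. d \<in> edges G \<and> d \<noteq> e \<and> ends G d = {#f i, f (Suc i)#}"
    using f(3) by (auto simp: adjacency_def delete_edges_def)
  then obtain g where g: "\<And>i. i < n \<Longrightarrow> g i \<in> edges G \<and> g i \<noteq> e \<and> ends G (g i) = {#f i, f (Suc i)#}"
    by metis
  \<comment> \<open>Index \<open>n\<close> belongs to the closing edge \<open>e\<close>, from
    \<open>f n = a\<close> back to \<open>f 0 = b\<close>.\<close>
  define h where "h i = (if i < n then g i else e)" for i
  have "is_cycle G (map (\<lambda>i. (f i, h i)) [0..<Suc n])"
    unfolding is_cycle_def
  proof (intro conjI allI impI)
    show "distinct (map fst (map (\<lambda>i. (f i, h i)) [0..<Suc n]))"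
      using inj by (auto simp: distinct_map inj_on_def simp del: upt_Suc)
    have "i = k" if "h i = h k" "i \<le> n" "k \<le> n" for i k
    proof (cases "i < n \<and> k < n")
      case True
      \<comment> \<open>Equal edges have equal ends; matching them crosswise would need both
        \<open>i = Suc k\<close> and \<open>Suc i = k\<close>.\<close>
      then have "{#f i, f (Suc i)#} = {#f k, f (Suc k)#}"
        using that(1) g[of i] g[of k] by (simp add: h_def)
      then show ?thesis
        using inj[of i k] inj[of i "Suc k"] inj[of "Suc i" k] True by (auto simp: pair_mset_eq_iff)
    next
      case False
      then show ?thesis
        using that g[of i] g[of k] by (auto simp: h_def split: if_splits)
    qed
    then show "distinct (map snd (map (\<lambda>i. (f i, h i)) [0..<Suc n]))"
      by (auto simp: distinct_map inj_on_def simp del: upt_Suc)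
  next
    fix i assume "i < length (map (\<lambda>i. (f i, h i)) [0..<Suc n])"
    then have i: "i \<le> n" by simp
    then show "snd (map (\<lambda>i. (f i, h i)) [0..<Suc n] ! i) \<in> edges G"
      using g[of i] assms(3) by (simp add: h_def del: upt_Suc)
    show "ends G (snd (map (\<lambda>i. (f i, h i)) [0..<Suc n] ! i)) =
      {#fst (map (\<lambda>i. (f i, h i)) [0..<Suc n] ! i), fst (map (\<lambda>i. (f i, h i)) [0..<Suc n] !
        (Suc i mod length (map (\<lambda>i. (f i, h i)) [0..<Suc n])))#}"
      using i g[of i] f(1,2) e by (cases "i = n") (simp_all add: h_def del: upt_Suc)
  qed simp
  then show ?thesis ..
qed

lemma ex_cycle_cubic:
  assumes "graph G" "cubic G" "edge_connected 2 G"
  shows "\<exists>C. is_cycle G C"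
proof -
  have "verts G \<noteq> {}"
    using assms(3) by (auto simp: edge_connected_def)
  then obtain v where "degree G v = 3"
    using assms(2) by (auto simp: regular_def)
  then have "edges G \<noteq> {}"
    by (auto simp: degree_def)
  then show ?thesis
    using ex_cycle_through_edge[OF assms(1,3)] by blast
qed

text \<open>Supplies a cycle when nothing is blown up and all edges of \<open>G\<close> are
  kept.\<close>

lemma is_cycle_Orig:
  assumes C: "is_cycle G C" and "ends H = blow_ends G" "OrigE ` edges G \<subseteq> edges H"
  shows "is_cycle H (map (map_prod Orig OrigE) C)"
proof -
  have "map fst (map (map_prod Orig OrigE) C) = map Orig (map fst C)"
    "map snd (map (map_prod Orig OrigE) C) = map OrigE (map snd C)"
    by simp_all
  moreover have "distinct (map Orig (map fst C))" "distinct (map OrigE (map snd C))"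
    using C by (simp_all only: is_cycle_def distinct_map[of _ "map _ C"] inj_on_def blow_vertex.inject blow_edge.inject) simp_all
  moreover have "snd (map (map_prod Orig OrigE) C ! k) \<in> edges H"
    "ends H (snd (map (map_prod Orig OrigE) C ! k)) = {#fst (map (map_prod Orig OrigE) C ! k),
      fst (map (map_prod Orig OrigE) C ! (Suc k mod length C))#}" if "k < length C" for k
  proof -
    have "Suc k mod length C < length C"
      using that by (intro mod_less_divisor) auto
    moreover have "snd (C ! k) \<in> edges G"
      "ends G (snd (C ! k)) = {#fst (C ! k), fst (C ! (Suc k mod length C))#}"
      using C that by (simp_all add: is_cycle_def)
    ultimately show "snd (map (map_prod Orig OrigE) C ! k) \<in> edges H"
      "ends H (snd (map (map_prod Orig OrigE) C ! k)) = {#fst (map (map_prod Orig OrigE) C ! k),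
        fst (map (map_prod Orig OrigE) C ! (Suc k mod length C))#}"
      using that assms(2,3) by auto
  qed
  moreover have "C \<noteq> []"
    using C by (simp add: is_cycle_def)
  ultimately show ?thesis
    unfolding is_cycle_def by (simp only: length_map) simp
qed

text \<open>The 5-cycle 2, 3, 8, 5, 7 of \<open>B\<close> supplies a cycle as soon as there is one
  copy.\<close>

lemma is_cycle_in_B:
  fixes H :: "('v blow_vertex, ('v, 'e) blow_edge) pre_graph"
  assumes "ends H = blow_ends G" "B_edge j i ` B_edges \<subseteq> edges H"
  shows "is_cycle H [(InB j i 2, B_edge j i {#2, 3#}), (InB j i 3, B_edge j i {#3, 8#}),
    (InB j i 8, B_edge j i {#8, 5#}), (InB j i 5, B_edge j i {#5, 7#}), (InB j i 7, B_edge j i {#2, 7#})]"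
    (is "is_cycle H ?C")
proof -
  have "B_edge j i ` {{#2, 3#}, {#3, 8#}, {#8, 5#}, {#5, 7#}, {#2, 7#}} \<subseteq> edges H"
    using assms(2) by (auto simp: B_edges_explicit)
  then show ?thesis
    unfolding is_cycle_def
    by (simp add: All_less_Suc assms(1) B_edge_def pair_mset_eq_iff)
qed

text \<open>For the \<open>Max\<close> in \<open>circ\<close>, the cycle \<open>C\<close> makes the
  set of lengths nonempty and the bound makes it finite.\<close>

lemma circ_le:
  assumes "is_cycle H C" "\<And>K. is_cycle H K \<Longrightarrow> length K \<le> n"
  shows "circ H \<le> n"
proof -
  have "{length K | K. is_cycle H K} \<subseteq> {..n}"
    by (auto dest: assms(2))
  moreover have "length C \<in> {length K | K. is_cycle H K}"
    using assms(1) by blast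
  ultimately show ?thesis
    unfolding circ_def by (subst Max_le_iff) (auto intro: finite_subset)
qed

section \<open>Counting over positions\<close>

lemma ceiling_half: "\<lceil>real m / 2\<rceil> = int ((m + 1) div 2)"
  by (cases "even m") (auto elim!: evenE oddE simp: ceiling_eq_iff field_simps)

lemma positions_Sigma: "positions Cs = Sigma {..<length Cs} (\<lambda>j. {..<length (Cs ! j)})"
  by (auto simp: positions_def)

lemma finite_positions: "finite (positions Cs)"
  by (simp add: positions_Sigma)

lemma card_subset_positions:
  assumes "Q \<subseteq> positions Cs"
  shows "card Q = (\<Sum>j<length Cs. card (Q `` {j}))"
proof -
  have "Q = Sigma {..<length Cs} (\<lambda>j. Q `` {j})"
    using assms by (auto simp: positions_def)
  moreover have "finite (Q `` {j})" for j
    using finite_subset[OF assms finite_positions] by (rule finite_Image)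
  ultimately show ?thesis
    by (metis card_SigmaI finite_lessThan)
qed

context cycle_system
begin

text \<open>\<open>X\<close> plays the part of the vertex set of a cycle. Every position starts a
  triple that is wholly covered or misses something; an incomplete copy spoils at most two triples,
  a missed cycle vertex only one.\<close>

lemma count_missed:
  fixes V X :: "'v blow_vertex set"
  assumes fin: "finite V" and XV: "X \<subseteq> V"
    and B_in: "\<And>j i. (j, i) \<in> positions Cs \<Longrightarrow> InB j i ` B_verts \<subseteq> V"
    and v_in: "\<And>j i. (j, i) \<in> positions Cs \<Longrightarrow> cyc_vertex Cs j i \<in> V"
    and covered: "\<And>j i. (j, i) \<in> positions Cs \<Longrightarrow> InB j i ` B_verts \<subseteq> X \<Longrightarrow>
      InB j (next_pos Cs j i) ` B_verts \<subseteq> X \<Longrightarrow> cyc_vertex Cs j (next_pos Cs j i) \<in> X \<Longrightarrow>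
      X \<inter> range Orig \<subseteq> {cyc_vertex Cs j (next_pos Cs j i)}"
  shows "card X + (\<Sum>j<length Cs. (length (Cs ! j) + 1) div 2) \<le> card V + 1"
proof -
  let ?P = "positions Cs" and ?v = "cyc_vertex Cs :: nat \<Rightarrow> nat \<Rightarrow> 'v blow_vertex"
  define LB where "LB = {(j, i) \<in> ?P. \<not> InB j i ` B_verts \<subseteq> X}"
  define LV where "LV = {(j, i) \<in> ?P. ?v j i \<notin> X}"
  define T where "T = {(j, i) \<in> ?P. (j, i) \<notin> LB \<and> (j, next_pos Cs j i) \<notin> LV \<and> (j, next_pos Cs j i) \<notin> LB}"
  have sub: "LB \<subseteq> ?P" "LV \<subseteq> ?P" "T \<subseteq> ?P"
    by (auto simp: LB_def LV_def T_def)
  note fin_sub = sub[THEN finite_subset, OF finite_positions]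
  \<comment> \<open>A covered triple leaves its middle vertex as the only original vertex in
    \<open>X\<close>, so all members of \<open>T\<close> share this vertex and hence
    coincide.\<close>
  have T_cov: "X \<inter> range Orig = {?v j (next_pos Cs j i)}" if "(j, i) \<in> T" for j i
  proof -
    have P: "(j, i) \<in> ?P" "(j, next_pos Cs j i) \<in> ?P"
      using that sub next_pos_less by blast+
    with that have "InB j i ` B_verts \<subseteq> X" "InB j (next_pos Cs j i) ` B_verts \<subseteq> X"
      and v: "?v j (next_pos Cs j i) \<in> X"
      by (auto simp: T_def LB_def LV_def)
    from covered[OF P(1) this] v show ?thesis
      by (auto simp: cyc_vertex_def)
  qed
  have "x = y" if xy: "x \<in> T" "y \<in> T" for x y
  proof -
    obtain j i where x: "x = (j, i)" by fastforce
    obtain l k where y: "y = (l, k)" by fastforce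
    have P: "(j, i) \<in> ?P" "(l, k) \<in> ?P"
      using xy sub by (auto simp: x y)
    have "?v j (next_pos Cs j i) = ?v l (next_pos Cs l k)"
      using T_cov xy unfolding x y by blast
    then show ?thesis
      using cyc_vertex_inject[OF next_pos_less[OF P(1)] next_pos_less[OF P(2)]]
        next_pos_inject[of j i Cs k] P by (auto simp: x y)
  qed
  then have T: "card T \<le> 1"
    using fin_sub(3) by (simp add: card_le_Suc0_iff_eq)
  \<comment> \<open>One missed vertex is chosen in each incomplete copy. These are distinct and,
    being of the form \<open>InB\<close>, differ from the vertices counted by
    \<open>LV\<close>.\<close>
  have "\<forall>x\<in>LB. \<exists>q. InB (fst x) (snd x) q \<in> V - X"
    using B_in by (fastforce simp: LB_def)
  then obtain q where q: "\<And>x. x \<in> LB \<Longrightarrow> InB (fst x) (snd x) (q x) \<in> V - X"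
    by metis
  let ?f = "\<lambda>x. InB (fst x) (snd x) (q x) :: 'v blow_vertex" and ?g = "\<lambda>x. ?v (fst x) (snd x)"
  have "inj_on ?f LB"
    by (auto simp: inj_on_def prod_eq_iff)
  moreover have "inj_on ?g LV"
    using sub(2) cyc_vertex_inject by (fastforce simp: inj_on_def)
  moreover have "?f ` LB \<inter> ?g ` LV = {}"
    by (auto simp: cyc_vertex_def)
  ultimately have "card LB + card LV = card (?f ` LB \<union> ?g ` LV)"
    using fin_sub by (simp add: card_Un_disjoint card_image)
  also have "\<dots> \<le> card (V - X)"
    using q v_in fin by (intro card_mono) (auto simp: LV_def)
  finally have missed: "card LB + card LV \<le> card (V - X)" .
  have "(length (Cs ! j) + 1) div 2 \<le> card (LB `` {j}) + card (LV `` {j}) + card (T `` {j})" (is "?lhs \<le> ?rhs")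
    if "j < length Cs" for j
  proof -
    let ?m = "length (Cs ! j)"
    have fin_j: "finite (LB `` {j})" "finite (LV `` {j})" "finite (T `` {j})"
      using fin_sub by auto
    have pre: "card {i \<in> {..<?m}. next_pos Cs j i \<in> S} \<le> card S" if "finite S" for S
      using that bij_betw_imp_inj_on[OF next_pos_bij, of Cs j]
      by (intro card_inj_on_le[of "next_pos Cs j"]) (auto simp: inj_on_def)
    \<comment> \<open>\<open>LB\<close> occurs twice because an incomplete copy can be the first or
      the last part of a triple.\<close>
    let ?U = "T `` {j} \<union> (LB `` {j} \<union> ({i \<in> {..<?m}. next_pos Cs j i \<in> LV `` {j}} \<union>
        {i \<in> {..<?m}. next_pos Cs j i \<in> LB `` {j}}))"
    have "{..<?m} \<subseteq> ?U"
      using that by (auto simp: T_def positions_def)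
    moreover have "finite ?U"
      using fin_j by simp
    ultimately have "?m \<le> card ?U"
      using card_mono[of ?U "{..<?m}"] by simp
    also have "\<dots> \<le> card (T `` {j}) + (card (LB `` {j}) + (card (LV `` {j}) + card (LB `` {j})))"
      using pre[OF fin_j(2)] pre[OF fin_j(1)] by (intro card_Un_le[THEN order_trans] add_mono order_refl)
    \<comment> \<open>The bound has the form \<open>m \<le> t + 2 * b + v\<close>, so
      \<open>(m + 1) div 2\<close> is at most \<open>b + (t + v + 1) div 2\<close>, which is at most
      \<open>b + t + v\<close>.\<close>
    finally show ?thesis
      by linarith
  qed
  then have "(\<Sum>j<length Cs. (length (Cs ! j) + 1) div 2) \<le>
    (\<Sum>j<length Cs. card (LB `` {j}) + card (LV `` {j}) + card (T `` {j}))"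
    by (intro sum_mono) auto
  also have "\<dots> = card LB + card LV + card T"
    using sub by (simp add: card_subset_positions sum.distrib)
  \<comment> \<open>The one covered triple that may exist, over all cycles together, is the source
    of the summand 1.\<close>
  also have "\<dots> \<le> card (V - X) + 1"
    using missed T by simp
  finally show ?thesis
    using card_Diff_subset[OF finite_subset[OF XV fin] XV] card_mono[OF fin XV] by simp
qed

lemma Orig_cyc_vertex: "(j, i) \<in> positions Cs \<Longrightarrow> cyc_vertex Cs j i \<in> Orig ` verts G"
  using cyc_vertex_in_verts by (auto simp: cyc_vertex_def)

text \<open>Serves both constructions; what the connections between the copies achieve enters
  through \<open>covered\<close>.\<close>

lemma circ_bound:
  fixes H :: "('v blow_vertex, ('v, 'e) blow_edge) pre_graph"
  assumes conn: "edge_connected 2 G" and ends: "ends H = blow_ends G"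
    and verts: "finite (verts H)" "Orig ` verts G \<union> B_copies_verts Cs \<subseteq> verts H"
    and edges: "kept_edges G Cs \<union> B_copies_edges Cs \<subseteq> edges H"
    and ends_in: "\<And>e. e \<in> edges H \<Longrightarrow> set_mset (blow_ends G e) \<subseteq> verts H"
    and covered: "\<And>K j i. is_cycle H K \<Longrightarrow> (j, i) \<in> positions Cs \<Longrightarrow> InB j i ` B_verts \<subseteq> cycle_verts K \<Longrightarrow>
      InB j (next_pos Cs j i) ` B_verts \<subseteq> cycle_verts K \<Longrightarrow> cyc_vertex Cs j (next_pos Cs j i) \<in> cycle_verts K \<Longrightarrow>
      cycle_verts K \<inter> range Orig \<subseteq> {cyc_vertex Cs j (next_pos Cs j i)}"
  shows "int (circ H) \<le> int (card (verts H)) - (\<Sum>i<length Cs. \<lceil>real (card (cycle_verts (Cs ! i))) / 2\<rceil>) + 1"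
proof -
  let ?s = "\<Sum>j<length Cs. (length (Cs ! j) + 1) div 2"
  have len: "length K + ?s \<le> card (verts H) + 1" if K: "is_cycle H K" for K
  proof -
    have sub: "cycle_verts K \<subseteq> verts H"
      using cycle_verts_subset[OF K] ends_in by (simp add: ends)
    have B_in: "InB j i ` B_verts \<subseteq> verts H" if "(j, i) \<in> positions Cs" for j i
    proof -
      have "InB j i ` B_verts \<subseteq> B_copies_verts Cs"
        using that by (auto simp: B_copies_verts_def intro!: bexI[of _ "(j, i)"])
      then show ?thesis
        using verts(2) by blast
    qed
    have v_in: "cyc_vertex Cs j i \<in> verts H" if "(j, i) \<in> positions Cs" for j i
      using Orig_cyc_vertex[OF that] verts(2) by blast
    show ?thesis
      using count_missed[OF verts(1) sub B_in v_in covered[OF K]] by (simp add: card_cycle_verts[OF K])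
  qed
  \<comment> \<open>Without positions all edges of \<open>G\<close> are kept, and \<open>G\<close>
    has a cycle; otherwise a copy of \<open>B\<close> contains one.\<close>
  have "\<exists>C. is_cycle H C"
  proof (cases "positions Cs = {}")
    case True
    then have "\<forall>C\<in>set Cs. C = []"
      by (fastforce simp: positions_def in_set_conv_nth)
    then have "(\<Union>C\<in>set Cs. cycle_edges C) = {}"
      by (simp add: cycle_edges_def)
    then have "kept_edges G Cs = OrigE ` edges G"
      by (simp add: kept_edges_def)
    then show ?thesis
      using ex_cycle_cubic[OF graph_G cubic_G conn] is_cycle_Orig[OF _ ends] edges by blast
  next
    case False
    then obtain j i where "(j, i) \<in> positions Cs"
      by fastforce
    then have "B_edge j i ` B_edges \<subseteq> B_copies_edges Cs"
      by (auto simp: B_copies_edges_def B_edge_def intro!: bexI[of _ "(j, i)"])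
    then have "B_edge j i ` B_edges \<subseteq> edges H"
      using edges by blast
    then show ?thesis
      using is_cycle_in_B[OF ends] by blast
  qed
  then obtain C where "is_cycle H C" ..
  then have "circ H \<le> card (verts H) + 1 - ?s"
  proof (rule circ_le)
    fix K assume "is_cycle H K"
    from len[OF this] show "length K \<le> card (verts H) + 1 - ?s"
      by linarith
  qed
  \<comment> \<open>Ensures that the subtraction of naturals in the bound on \<open>circ H\<close>
    does not truncate.\<close>
  moreover have "?s \<le> card (verts H) + 1"
    using len[OF \<open>is_cycle H C\<close>] by simp
  ultimately have "int (circ H) + int ?s \<le> int (card (verts H)) + 1"
    by linarith
  moreover have "(\<Sum>i<length Cs. \<lceil>real (card (cycle_verts (Cs ! i))) / 2\<rceil>) = int ?s"
    using card_cycle_verts[OF Cs_cycle] by (simp add: ceiling_half)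
  ultimately show ?thesis
    by linarith
qed

section \<open>Finiteness and edge ends of the two constructions\<close>

lemma finite_verts: "finite (verts (blowup G Cs))" "finite (verts (semiblowup G Cs))"
  using graph_G
  by (simp_all add: graph_def blowup_def semiblowup_def B_copies_verts_def B_verts_explicit
      finite_positions split_beta)

lemma kept_ends_in: "e \<in> kept_edges G Cs \<Longrightarrow> set_mset (blow_ends G e) \<subseteq> Orig ` verts G"
  using graph_G by (fastforce simp: kept_edges_def graph_def)

lemma B_edge_ends_in:
  assumes "(j, i) \<in> positions Cs" "s \<in> B_edges"
  shows "set_mset (blow_ends G (B_edge j i s)) \<subseteq> B_copies_verts Cs"
proof -
  have "set_mset s \<subseteq> B_verts"
    using assms(2) by (auto simp: B_edges_explicit B_verts_explicit)
  then show ?thesis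
    using assms(1) by (fastforce simp: B_edge_def B_copies_verts_def)
qed

lemma semi_in: "(j, i) \<in> positions Cs \<Longrightarrow> semi j i s \<in> B_copies_verts Cs"
  using foot_in_B_verts by (fastforce simp: semi_def B_copies_verts_def)

lemma semiblowup_ends_in:
  assumes "e \<in> edges (semiblowup G Cs)"
  shows "set_mset (blow_ends G e) \<subseteq> verts (semiblowup G Cs)"
proof -
  have "set_mset (blow_ends G e) \<subseteq> Orig ` verts G \<union> B_copies_verts Cs"
    using assms
  proof (cases rule: semiblowup_edgeE)
    case 1
    then show ?thesis using kept_ends_in by blast
  next
    case 2
    then show ?thesis using B_edge_ends_in by blast
  qed (use Orig_cyc_vertex semi_in next_pos_less in fastforce)+
  then show ?thesis
    by (simp add: semiblowup_def)
qed

lemma blowup_ends_in: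
  assumes "e \<in> edges (blowup G Cs)"
  shows "set_mset (blow_ends G e) \<subseteq> verts (blowup G Cs)"
proof -
  let ?UW = "(\<Union>(j, i)\<in>positions Cs. {U j i, W j i})"
  have UW: "U j i \<in> ?UW" "W j i \<in> ?UW" if "(j, i) \<in> positions Cs" for j i
    using that by auto
  have "set_mset (blow_ends G e) \<subseteq> Orig ` verts G \<union> B_copies_verts Cs \<union> ?UW"
    using assms
  proof (cases rule: blowup_edgeE)
    case 1
    then show ?thesis using kept_ends_in by blast
  next
    case 2
    then show ?thesis using B_edge_ends_in by blast
  qed (simp, use Orig_cyc_vertex semi_in next_pos_less UW in blast)+
  then show ?thesis
    by (simp add: blowup_def)
qed

end

theorem corollary4p6:
  fixes G D :: "('v, 'e) pre_graph" and Cs :: "('v \<times> 'e) list list"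
  assumes "graph G" and "cubic G" and "edge_connected 2 G"
    and "subgraph D G" and "regular 2 D" and "disjoint_cycles D Cs"
  shows "int (circ (blowup G Cs)) \<le> int (card (verts (blowup G Cs)))
           - (\<Sum>i<length Cs. \<lceil>real (card (cycle_verts (Cs ! i))) / 2\<rceil>) + 1
       \<and> int (circ (semiblowup G Cs)) \<le> int (card (verts (semiblowup G Cs)))
           - (\<Sum>i<length Cs. \<lceil>real (card (cycle_verts (Cs ! i))) / 2\<rceil>) + 1"
proof -
  interpret cycle_system G D Cs
    using assms by unfold_locales
  show ?thesis
  proof (intro conjI circ_bound assms(3) ends_blowup ends_semiblowup finite_verts
      blowup_ends_in semiblowup_ends_in)
    show "Orig ` verts G \<union> B_copies_verts Cs \<subseteq> verts (blowup G Cs)"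
      "kept_edges G Cs \<union> B_copies_edges Cs \<subseteq> edges (blowup G Cs)"
      by (auto simp: blowup_def)
    show "Orig ` verts G \<union> B_copies_verts Cs \<subseteq> verts (semiblowup G Cs)"
      "kept_edges G Cs \<union> B_copies_edges Cs \<subseteq> edges (semiblowup G Cs)"
      by (auto simp: semiblowup_def)
  \<comment> \<open>What remains in both cases is the hypothesis \<open>covered\<close> of
    \<open>circ_bound\<close>.\<close>
  qed (assumption | rule blowup_covered semiblowup_covered refl)+
qed

end
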